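(* Let $\Phi\colon[0,\infty)\to[0,\infty)$, $\Phi(0)=0$, be a continuous strictly increasing function such that $$\limsup_{r\to0}\frac{\Phi(2r)}{\Phi(r)}<4$$ and $$M(r):=\frac{\Phi(r)}{\varphi(r)}\to\infty\quad\text{as } r\to0.$$ Then there exist a compact set $K\subset\mathbb{C}$ with $H^\Phi(K)>0$ and a finite (real, not necessarily positive) Borel measure in $\mathbb{C}$, for which $\log(1+|w|)$ is integrable with respect to its total variation, whose logarithmic potential is not differentiable in the weak capacity sense at $H^\Phi$ almost all points of $K$ (that is, the set of points of $K$ at which it is differentiable in the weak capacity sense has zero $H^\Phi$ measure).
   Context: $B(a,r)$ is the disc of center $a$ and radius $r$; $\mathbb{C}$ is identified with $\mathbb{R}^2$. The logarithmic potential of a finite Borel measure $\nu$ in $\mathbb{C}$ is $u(z)=\int_{\mathbb{C}}\log\frac{1}{|z-w|}\,d\nu(w)$. $\varphi(t)=t\,\frac{1}{\log(1/t)}$ for $0<t\le e^{-1}$ and $\varphi(t)=t$ for $t\ge e^{-1}$. $H^\Phi$ is the Hausdorff measure associated with $\Phi$: $H^\Phi(E)=\lim_{\delta\to0}\inf\{\sum_i\Phi(\operatorname{diam}E_i):E\subset\bigcup_iE_i,\ \operatorname{diam}E_i\le\delta\}$ (countable coverings). Wiener capacity: for a compact set $E$ contained in a disc of radius $1/2$, $\operatorname{Cap}(E)=\sup\nu(E)$, the supremum being over all positive finite Borel measures $\nu$ supported on $E$ with $\int\log\frac{1}{|z-w|}\,d\nu(w)\le1$ for all $z\in\mathbb{C}$.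 For a non-compact Borel set contained in a disc of radius $1/2$, $\operatorname{Cap}$ is the supremum of the capacities of its compact subsets. Differentiability in the weak capacity sense: a real function $u$ is differentiable in the weak capacity sense at $a\in\mathbb{R}^2$ if there exist real numbers $A_1,A_2$ such that $$\lim_{r\to0}\frac{\sup_{t>0}t\,\operatorname{Cap}(\{x\in B(a,r):|u(x)-u(a)-\sum_{i=1}^2A_i(x_i-a_i)|>t\})}{r\,\operatorname{Cap}(B(a,r))}=0.$$ In particular the integral defining $u(a)$ is required to converge absolutely. The potential $u$ is defined outside a set of capacity zero; points $x$ where it is not defined play no role in the definition. *)

theory Defs
  imports "HOL-Analysis.Analysis"
begin

definition phi :: "real \<Rightarrow> real" where
  "phi t = (if t \<le> exp (-1) then t * (1 / ln (1 / t)) else t)"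

text \<open>Countable coverings are sequences, which may contain the empty set (of diameter \<open>0\<close>).
  Boundedness is explicit because \<^const>\<open>diameter\<close> is meaningful only for bounded sets.\<close>

definition hausdorff_content :: "(real \<Rightarrow> real) \<Rightarrow> real \<Rightarrow> 'a::metric_space set \<Rightarrow> ennreal" where
  "hausdorff_content \<Phi> \<delta> S =
     (INF E \<in> {E :: nat \<Rightarrow> 'a set. S \<subseteq> (\<Union>i. E i) \<and> (\<forall>i. bounded (E i) \<and> diameter (E i) \<le> \<delta>)}.
        (\<Sum>i. ennreal (\<Phi> (diameter (E i)))))"

definition hausdorff_measure :: "(real \<Rightarrow> real) \<Rightarrow> 'a::metric_space set \<Rightarrow> ennreal" where
  "hausdorff_measure \<Phi> S = Lim (at_right 0) (\<lambda>\<delta>. hausdorff_content \<Phi> \<delta> S)"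

lemma hausdorff_content_antimono:
  "\<delta> \<le> \<epsilon> \<Longrightarrow> hausdorff_content \<Phi> \<epsilon> S \<le> hausdorff_content \<Phi> \<delta> S"
  unfolding hausdorff_content_def by (intro INF_superset_mono) (auto intro: order_trans)

text \<open>The limit always exists, so the use of \<^const>\<open>Lim\<close> is legitimate.\<close>

lemma hausdorff_content_tendsto_SUP:
  "((\<lambda>\<delta>. hausdorff_content \<Phi> \<delta> S) \<longlongrightarrow> (SUP \<delta>\<in>{0<..}. hausdorff_content \<Phi> \<delta> S)) (at_right 0)"
proof (rule increasing_tendsto)
  show "\<forall>\<^sub>F \<delta> in at_right 0. hausdorff_content \<Phi> \<delta> S \<le> (SUP \<delta>\<in>{0<..}. hausdorff_content \<Phi> \<delta> S)"
    unfolding eventually_at_right_field by (intro exI[of _ 1]) (auto intro!: SUP_upper)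
next
  fix c assume "c < (SUP \<delta>\<in>{0<..}. hausdorff_content \<Phi> \<delta> S)"
  then obtain d where d: "d > 0" "c < hausdorff_content \<Phi> d S"
    by (auto simp: less_SUP_iff)
  have "c < hausdorff_content \<Phi> \<delta> S" if "\<delta> < d" for \<delta>
    using d hausdorff_content_antimono[of \<delta> d \<Phi> S] that by (meson less_imp_le less_le_trans)
  then show "\<forall>\<^sub>F \<delta> in at_right 0. c < hausdorff_content \<Phi> \<delta> S"
    unfolding eventually_at_right_field using d by blast
qed

lemma hausdorff_measure_eq_SUP:
  "hausdorff_measure \<Phi> S = (SUP \<delta>\<in>{0<..}. hausdorff_content \<Phi> \<delta> S)"
  unfolding hausdorff_measure_def
  by (rule tendsto_Lim[OF trivial_limit_at_right_real hausdorff_content_tendsto_SUP])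

text \<open>The kernel is extended-real valued: \<open>ln (1 / 0) = 0\<close> in HOL, whereas the kernel must
  be \<open>\<infinity>\<close> on the diagonal.\<close>

definition log_kernel :: "complex \<Rightarrow> complex \<Rightarrow> ereal" where
  "log_kernel z w = (if w = z then \<infinity> else ereal (ln (1 / cmod (z - w))))"

text \<open>Potential of a positive measure, as the integral of the positive part of the kernel minus
  that of the negative part (\<^const>\<open>e2ennreal\<close> truncates negative values to \<open>0\<close>). The second
  integral is finite for finite measures carried by a bounded set.\<close>

definition ereal_potential :: "complex measure \<Rightarrow> complex \<Rightarrow> ereal" where
  "ereal_potential \<mu> z =
     enn2ereal (\<integral>\<^sup>+w. e2ennreal (log_kernel z w) \<partial>\<mu>)
     - enn2ereal (\<integral>\<^sup>+w. e2ennreal (- log_kernel z w) \<partial>\<mu>)"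

definition compact_capacity :: "complex set \<Rightarrow> ennreal" where
  "compact_capacity E =
     (SUP \<mu> \<in> {\<mu>. sets \<mu> = sets borel \<and> finite_measure \<mu> \<and> emeasure \<mu> (- E) = 0
                  \<and> (\<forall>z. ereal_potential \<mu> z \<le> 1)}. emeasure \<mu> E)"

text \<open>Meant for Borel sets contained in a disc of radius \<open>1/2\<close>.\<close>

definition capacity :: "complex set \<Rightarrow> ennreal" where
  "capacity E = (if compact E then compact_capacity E
                 else (SUP K \<in> {K. compact K \<and> K \<subseteq> E}. compact_capacity K))"

text \<open>Finite real Borel measures are countably additive set functions; values on
  non-Borel sets are irrelevant.\<close>

definition signed_borel_measure :: "(complex set \<Rightarrow> real) \<Rightarrow> bool" where
  "signed_borel_measure \<nu> \<longleftrightarrow>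
     (\<forall>A :: nat \<Rightarrow> complex set. range A \<subseteq> sets borel \<longrightarrow> disjoint_family A \<longrightarrow>
        (\<lambda>i. \<nu> (A i)) sums \<nu> (\<Union>i. A i))"

text \<open>Jordan decomposition \<open>\<nu> = \<nu>\<^sup>+ - \<nu>\<^sup>-\<close>, with total variation \<open>\<nu>\<^sup>+ + \<nu>\<^sup>-\<close>.\<close>

definition pos_variation :: "(complex set \<Rightarrow> real) \<Rightarrow> complex measure" where
  "pos_variation \<nu> =
     measure_of UNIV (sets borel) (\<lambda>E. SUP A \<in> {A \<in> sets borel. A \<subseteq> E}. ennreal (\<nu> A))"

definition neg_variation :: "(complex set \<Rightarrow> real) \<Rightarrow> complex measure" where
  "neg_variation \<nu> = pos_variation (\<lambda>A. - \<nu> A)"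

definition total_variation :: "(complex set \<Rightarrow> real) \<Rightarrow> complex measure" where
  "total_variation \<nu> =
     measure_of UNIV (sets borel) (\<lambda>E. emeasure (pos_variation \<nu>) E + emeasure (neg_variation \<nu>) E)"

text \<open>The points where the integral defining the potential converges absolutely.\<close>

definition potential_domain :: "(complex set \<Rightarrow> real) \<Rightarrow> complex set" where
  "potential_domain \<nu> = {z. (\<integral>\<^sup>+w. e2ennreal \<bar>log_kernel z w\<bar> \<partial>(total_variation \<nu>)) < \<infinity>}"

text \<open>Only used on \<^const>\<open>potential_domain\<close>, where \<open>{z}\<close> is a null set of the total variation, so
  that the value of the integrand at \<open>w = z\<close> does not matter.\<close>

definition log_potential :: "(complex set \<Rightarrow> real) \<Rightarrow> complex \<Rightarrow> real" where
  "log_potential \<nu> z =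
     (\<integral>w. ln (1 / cmod (z - w)) \<partial>(pos_variation \<nu>))
     - (\<integral>w. ln (1 / cmod (z - w)) \<partial>(neg_variation \<nu>))"

text \<open>The set \<open>D\<close> is the domain of definition of the partial function \<open>u\<close>.\<close>

definition weak_capacity_differentiable ::
    "complex set \<Rightarrow> (complex \<Rightarrow> real) \<Rightarrow> complex \<Rightarrow> bool" where
  "weak_capacity_differentiable D u a \<longleftrightarrow> a \<in> D \<and>
     (\<exists>A1 A2 :: real.
        ((\<lambda>r. (SUP t \<in> {0<..}. ennreal t * capacity {x \<in> ball a r \<inter> D.
                  \<bar>u x - u a - (A1 * (Re x - Re a) + A2 * (Im x - Im a))\<bar> > t})
              / (ennreal r * capacity (ball a r))) \<longlongrightarrow> 0) (at_right 0))"

end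

theory Submission
  imports Defs
begin

text \<open>The gauge \<^const>\<open>phi\<close> is, for small \<open>r\<close>, \<open>r\<close> times the capacity of a disc of radius \<open>r\<close>. Hence a point mass
  of size \<open>phi r\<close> at distance less than \<open>r\<close> from \<open>a\<close> spoils differentiability at \<open>a\<close> on the scale
  \<open>r\<close>: near its pole the potential exceeds every level \<open>t\<close>, and the product of \<open>t\<close> with the capacity
  of the set where it does so tends to the mass as \<open>t \<rightarrow> \<infinity>\<close>
  (\<open>weak_capacity_size_near_atom\<close>). No constant or linear function can compensate this. So the
  measure can even be taken positive and purely atomic, and there is no cancellation to control: it
  suffices that every point of \<open>K\<close> has such atoms nearby on arbitrarily small scales, that the
  masses are summable, and that the atoms are isolated, so that the potential is defined around
  each of them (\<open>exists_nowhere_differentiable_potential\<close>). The potential is then differentiable at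
  no point of \<open>K\<close>.

  It remains to find a compact set with \<open>H\<^sup>\<Phi>(K) > 0\<close> that has, for a sequence of radii \<open>R n\<close>,
  coverings by \<open>N n\<close> discs of radius \<open>R n\<close> for which \<open>\<Sum>n. N n * phi (R n)\<close> converges. This is
  possible because \<open>\<Phi> / phi\<close> is unbounded: \<open>N n * phi (R n)\<close> may decrease like \<open>(1/2) ^ n\<close> while
  \<open>N n * \<Phi> (R n)\<close> stays bounded below, provided the radii decrease fast enough.

  The set is the closure of the image of the unit square under a map that acts on both coordinates
  by a staircase function with jumps at the dyadic points of a sparse sequence of generations. On
  the square, the map separates points so strongly that \<open>(x - y)\<^sup>2 \<le> 12 * \<Phi> \<bar>f x - f y\<bar>\<close> in each
  coordinate when the images are close (\<open>square_le_gauge_stair_diff\<close>). Thus the preimage of a set of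
  small diameter \<open>d\<close> has area at most a constant times \<open>\<Phi> d\<close>, and comparing areas in the square
  bounds the Hausdorff measure from below (\<open>hausdorff_measure_cantor_pos\<close>). Spreading the jumps
  evenly in two dimensions takes care of the scales between two generations, on which nothing but
  the lower bound \<open>\<Phi> \<ge> 2 ^ n * phi\<close> is available.\<close>

section \<open>Logarithmic capacity of discs\<close>

lemma compact_capacity_mono:
  assumes "compact E" "compact F" "E \<subseteq> F"
  shows "compact_capacity E \<le> compact_capacity F"
  unfolding compact_capacity_def
proof (rule SUP_mono)
  fix \<mu> :: "complex measure"
  assume \<mu>: "\<mu> \<in> {\<mu>. sets \<mu> = sets borel \<and> finite_measure \<mu> \<and> emeasure \<mu> (- E) = 0
                  \<and> (\<forall>z. ereal_potential \<mu> z \<le> 1)}"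
  have F: "F \<in> sets \<mu>"
    using \<mu> assms by (auto intro: borel_compact)
  show "\<exists>\<mu>'\<in>{\<mu>. sets \<mu> = sets borel \<and> finite_measure \<mu> \<and> emeasure \<mu> (- F) = 0
                  \<and> (\<forall>z. ereal_potential \<mu> z \<le> 1)}. emeasure \<mu> E \<le> emeasure \<mu>' F"
  proof (intro bexI[of _ \<mu>])
    show "emeasure \<mu> E \<le> emeasure \<mu> F"
      using F assms by (intro emeasure_mono)
    have "E \<in> sets borel" using assms by (intro borel_compact)
    then have "- E \<in> sets \<mu>" using \<mu> by auto
    then have "emeasure \<mu> (- F) \<le> emeasure \<mu> (- E)"
      using assms by (intro emeasure_mono) auto
    then show "\<mu> \<in> {\<mu>. sets \<mu> = sets borel \<and> finite_measure \<mu> \<and> emeasure \<mu> (- F) = 0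
                  \<and> (\<forall>z. ereal_potential \<mu> z \<le> 1)}"
      using \<mu> by auto
  qed
qed

lemma le_capacity:
  assumes "compact E" "E \<subseteq> S"
  shows "compact_capacity E \<le> capacity S"
  using assms compact_capacity_mono[of E S]
  by (auto simp: capacity_def intro: SUP_upper)

text \<open>For a competing measure carried by \<open>E\<close>, evaluate the potential at the centre \<open>a\<close>: there the
  kernel is at least \<open>ln (1 / r)\<close> on all of \<open>E\<close>.\<close>

lemma compact_capacity_le:
  assumes "compact E" "E \<subseteq> ball a r" "0 < r" "r < 1"
  shows "compact_capacity E \<le> ennreal (1 / ln (1 / r))"
  unfolding compact_capacity_def
proof (rule SUP_least)
  fix \<mu> :: "complex measure"
  assume "\<mu> \<in> {\<mu>. sets \<mu> = sets borel \<and> finite_measure \<mu> \<and> emeasure \<mu> (- E) = 0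
                  \<and> (\<forall>z. ereal_potential \<mu> z \<le> 1)}"
  then have [simp, measurable_cong]: "sets \<mu> = sets borel" and fin: "finite_measure \<mu>"
    and 0: "emeasure \<mu> (- E) = 0" and pot: "ereal_potential \<mu> a \<le> 1" by auto
  define l where "l = ln (1 / r)"
  have l: "l > 0" using assms by (simp add: l_def)
  have E: "E \<in> sets \<mu>" using assms by (auto intro: borel_compact)
  have "- E \<in> null_sets \<mu>"
    using 0 E assms(1) by (auto simp: null_sets_def intro: borel_compact)
  then have AE_E: "AE w in \<mu>. w \<in> E" by (rule AE_I') auto
  have kernel: "ereal l \<le> log_kernel a w" if "w \<in> E" for w
    using that assms by (force simp: log_kernel_def l_def dist_norm frac_le)
  have "(\<integral>\<^sup>+w. e2ennreal (- log_kernel a w) \<partial>\<mu>) = (\<integral>\<^sup>+w. 0 \<partial>\<mu>)"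
  proof (rule nn_integral_cong_AE, use AE_E in eventually_elim)
    fix w assume "w \<in> E"
    then have "ereal l \<le> log_kernel a w" by (rule kernel)
    with l have "- log_kernel a w \<le> 0"
      by (metis ereal_less_eq(5) ereal_uminus_le_0_iff less_imp_le order_trans)
    then show "e2ennreal (- log_kernel a w) = 0" by (rule e2ennreal_neg)
  qed
  then have neg: "(\<integral>\<^sup>+w. e2ennreal (- log_kernel a w) \<partial>\<mu>) = 0" by simp
  have "ennreal l * emeasure \<mu> E = (\<integral>\<^sup>+w. ennreal l * indicator E w \<partial>\<mu>)"
    using E by (simp add: nn_integral_cmult_indicator)
  also have "\<dots> \<le> (\<integral>\<^sup>+w. e2ennreal (log_kernel a w) \<partial>\<mu>)"
    using kernel e2ennreal_mono by (intro nn_integral_mono) (force simp: indicator_def)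
  also have "\<dots> \<le> 1"
  proof -
    have "enn2ereal (\<integral>\<^sup>+w. e2ennreal (log_kernel a w) \<partial>\<mu>) \<le> enn2ereal 1"
      using pot neg by (simp add: ereal_potential_def one_ennreal.rep_eq zero_ennreal.rep_eq)
    then show ?thesis by (simp add: less_eq_ennreal.rep_eq)
  qed
  finally have "ennreal (l * measure \<mu> E) \<le> ennreal 1"
    using l fin by (simp add: finite_measure.emeasure_eq_measure ennreal_mult')
  then have "l * measure \<mu> E \<le> 1" by (subst (asm) ennreal_le_iff) auto
  then have "measure \<mu> E \<le> 1 / l" using l by (simp add: field_simps)
  then show "emeasure \<mu> E \<le> ennreal (1 / ln (1 / r))"
    using fin unfolding l_def by (simp add: finite_measure.emeasure_eq_measure ennreal_leI)
qed

lemma capacity_ball_le: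
  assumes "0 < r" "r < 1"
  shows "capacity (ball a r) \<le> ennreal (1 / ln (1 / r))"
  using assms compact_capacity_le[of _ a r]
  by (auto simp: capacity_def intro!: SUP_least)

text \<open>The layer-cake decomposition of the logarithm over dyadic discs. It replaces an integration in
  polar coordinates: the areas of the discs form a geometric series.\<close>

lemma ln_le_dyadic_count:
  assumes "0 < s" "z \<noteq> w"
  shows "ennreal (ln (s / cmod (z - w))) \<le> (\<Sum>k. ennreal (ln 2) * indicator (cball z (s * (1/2) ^ k)) w)"
proof (cases "cmod (z - w) \<le> s")
  case True
  define t where "t = s / cmod (z - w)"
  define n where "n = nat \<lfloor>log 2 t\<rfloor>"
  have t: "t \<ge> 1" using True assms by (simp add: t_def)
  then have lg: "log 2 t \<ge> 0" by simp
  have "log 2 t < real n + 1" using lg unfolding n_def by linarith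
  then have "ln t \<le> real (Suc n) * ln 2"
    by (simp add: log_def divide_simps) (simp add: algebra_simps)
  moreover have mem: "w \<in> cball z (s * (1/2) ^ k)" if "k \<le> n" for k
  proof -
    have "real n \<le> log 2 t" using lg unfolding n_def by linarith
    then have "2 powr real k \<le> t" using that t by (subst (asm) le_log_iff) (auto intro: order_trans[rotated] powr_mono)
    then have "2 ^ k \<le> t" by (simp add: powr_realpow)
    then have "2 ^ k * cmod (z - w) \<le> s" using assms by (simp add: t_def field_simps)
    then show ?thesis by (simp add: dist_norm field_simps)
  qed
  ultimately have "ennreal (ln t) \<le> ennreal (real (Suc n) * ln 2)" by (simp add: ennreal_leI)
  also have "\<dots> = (\<Sum>k<Suc n. ennreal (ln 2))" by (simp add: ennreal_mult' ennreal_of_nat_eq_real_of_nat flip: of_nat_Suc)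
  also have "\<dots> = (\<Sum>k<Suc n. ennreal (ln 2) * indicator (cball z (s * (1/2) ^ k)) w)"
    using mem by (intro sum.cong) (auto simp del: mem_cball)
  also have "\<dots> \<le> (\<Sum>k. ennreal (ln 2) * indicator (cball z (s * (1/2) ^ k)) w)"
    by (intro sum_le_suminf) auto
  finally show ?thesis by (simp add: t_def)
next
  case False
  then have "ln (s / cmod (z - w)) \<le> 0" using assms by (subst ln_le_zero_iff) auto
  then show ?thesis by (simp add: ennreal_neg)
qed

lemma nn_integral_ln_le:
  assumes "0 < s"
  shows "(\<integral>\<^sup>+w. ennreal (ln (s / cmod (z - w))) \<partial>lborel) \<le> ennreal (pi * s\<^sup>2)"
proof -
  have "(\<integral>\<^sup>+w. ennreal (ln (s / cmod (z - w))) \<partial>lborel)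
      \<le> (\<integral>\<^sup>+w. (\<Sum>k. ennreal (ln 2) * indicator (cball z (s * (1/2) ^ k)) w) \<partial>lborel)"
    using assms ln_le_dyadic_count[of s z]
    by (intro nn_integral_mono_AE) (use AE_lborel_singleton[of z] in eventually_elim, simp)
  also have "\<dots> = (\<Sum>k. \<integral>\<^sup>+w. ennreal (ln 2) * indicator (cball z (s * (1/2) ^ k)) w \<partial>lborel)"
    by (intro nn_integral_suminf borel_measurable_times_ennreal borel_measurable_indicator) auto
  also have "\<dots> = (\<Sum>k. ennreal (ln 2 * pi * s\<^sup>2 * (1/4) ^ k))"
  proof (intro suminf_cong)
    fix k
    have "((1/2) ^ k)\<^sup>2 = (1/4 :: real) ^ k"
      by (subst power_mult[symmetric], subst mult.commute, subst power_mult) (simp add: power2_eq_square)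
    then show "(\<integral>\<^sup>+w. ennreal (ln 2) * indicator (cball z (s * (1/2) ^ k)) w \<partial>lborel)
        = ennreal (ln 2 * pi * s\<^sup>2 * (1/4) ^ k)"
      using assms
      by (simp add: nn_integral_cmult_indicator emeasure_cball unit_ball_vol_2 power_mult_distrib
          mult_ac flip: ennreal_mult')
  qed
  also have "\<dots> = ennreal (ln 2 * pi * s\<^sup>2 * (4/3))"
  proof (rule suminf_ennreal_eq)
    show "(\<lambda>k. ln 2 * pi * s\<^sup>2 * (1/4) ^ k) sums (ln 2 * pi * s\<^sup>2 * (4/3))"
      using geometric_sums[of "1/4 :: real"] by (intro sums_mult) simp
  qed auto
  also have "\<dots> \<le> ennreal (pi * s\<^sup>2)"
  proof (rule ennreal_leI)
    have "ln 2 \<le> (3/4 :: real)"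
      using ln2_le_25_over_36 by simp
    then have "(ln 2 * (4/3)) * (pi * s\<^sup>2) \<le> 1 * (pi * s\<^sup>2)"
      by (intro mult_right_mono) auto
    then show "ln 2 * pi * s\<^sup>2 * (4/3) \<le> pi * s\<^sup>2" by (simp add: algebra_simps)
  qed
  finally show ?thesis .
qed

text \<open>The competing measure is a multiple of Lebesgue measure on the disc. The exact capacity is
  \<open>1 / ln (1 / s)\<close>; an additive constant in the denominator is harmless, because the estimate is
  used in the limit \<open>s \<rightarrow> 0\<close>.\<close>

lemma compact_capacity_cball_ge:
  assumes "0 < s" "s < 1"
  shows "ennreal (1 / (ln (1 / s) + 1)) \<le> compact_capacity (cball q s)"
proof -
  define l where "l = ln (1 / s)"
  have l: "l > 0" using assms by (simp add: l_def)
  define c where "c = 1 / (pi * s\<^sup>2 * (l + 1))"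
  have c: "c > 0" using l assms by (simp add: c_def)
  define \<mu> where "\<mu> = density lborel (\<lambda>w. ennreal c * indicator (cball q s) w)"
  have [simp, measurable_cong]: "sets \<mu> = sets borel" by (simp add: \<mu>_def)
  have em: "emeasure \<mu> A = ennreal c * emeasure lborel (cball q s \<inter> A)" if "A \<in> sets borel" for A
  proof -
    have "emeasure \<mu> A = (\<integral>\<^sup>+w. ennreal c * indicator (cball q s \<inter> A) w \<partial>lborel)"
      using that unfolding \<mu>_def
      by (subst emeasure_density) (auto simp: indicator_def intro!: nn_integral_cong)
    then show ?thesis using that by (simp add: nn_integral_cmult_indicator)
  qed
  have vol: "ennreal c * ennreal (pi * s\<^sup>2) = ennreal (1 / (l + 1))"
    using assms l c by (simp add: c_def flip: ennreal_mult')
  have "emeasure \<mu> (cball q s) = ennreal (1 / (l + 1))"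
    using assms vol by (simp add: em emeasure_cball unit_ball_vol_2)
  moreover have "emeasure \<mu> (cball q s) \<le> compact_capacity (cball q s)"
    unfolding compact_capacity_def
  proof (rule SUP_upper, safe)
    show "finite_measure \<mu>"
    proof (rule finite_measureI)
      have "emeasure \<mu> (space \<mu>) = ennreal c * emeasure lborel (cball q s)"
        by (simp add: em \<mu>_def[THEN arg_cong[where f=space]])
      then show "emeasure \<mu> (space \<mu>) \<noteq> \<infinity>" using assms
        by (simp add: emeasure_cball ennreal_mult_eq_top_iff)
    qed
    show "emeasure \<mu> (- cball q s) = 0" by (subst em) auto
    fix z
    have meas: "(\<lambda>w. e2ennreal (log_kernel z w)) \<in> borel_measurable borel"
      unfolding log_kernel_def by measurable
    have meas_ln: "(\<lambda>w. ennreal (ln (s / cmod (z - w)))) \<in> borel_measurable borel"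
      by measurable
    have meas_ind: "(\<lambda>w. ennreal l * indicator (cball q s) w) \<in> borel_measurable borel"
      by (intro borel_measurable_times_ennreal borel_measurable_indicator) auto
    have "(\<integral>\<^sup>+w. e2ennreal (log_kernel z w) \<partial>\<mu>)
        = (\<integral>\<^sup>+w. ennreal c * indicator (cball q s) w * e2ennreal (log_kernel z w) \<partial>lborel)"
      unfolding \<mu>_def using meas by (subst nn_integral_density) (measurable, auto)
    also have "\<dots> \<le> (\<integral>\<^sup>+w. ennreal c * (ennreal l * indicator (cball q s) w
                              + ennreal (ln (s / cmod (z - w)))) \<partial>lborel)"
    proof (rule nn_integral_mono_AE, use AE_lborel_singleton[of z] in eventually_elim)
      fix w assume "w \<noteq> z"
      then have "log_kernel z w = ereal (l + ln (s / cmod (z - w)))"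
        using assms by (simp add: log_kernel_def l_def ln_div)
      then have "e2ennreal (log_kernel z w) \<le> ennreal l + ennreal (ln (s / cmod (z - w)))"
        using l by (cases "ln (s / cmod (z - w)) \<ge> 0")
          (auto simp: ennreal_neg intro!: ennreal_leI simp flip: ennreal_plus)
      then show "ennreal c * indicator (cball q s) w * e2ennreal (log_kernel z w)
          \<le> ennreal c * (ennreal l * indicator (cball q s) w + ennreal (ln (s / cmod (z - w))))"
        by (auto simp: indicator_def intro: mult_left_mono)
    qed
    also have "\<dots> = ennreal c * (ennreal l * emeasure lborel (cball q s)
                    + (\<integral>\<^sup>+w. ennreal (ln (s / cmod (z - w))) \<partial>lborel))"
      using meas_ln meas_ind
      by (subst nn_integral_cmult, simp, subst nn_integral_add) (auto simp: nn_integral_cmult_indicator)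
    also have "\<dots> \<le> ennreal c * (ennreal l * ennreal (pi * s\<^sup>2) + ennreal (pi * s\<^sup>2))"
      using assms nn_integral_ln_le[of s z]
      by (intro mult_left_mono add_mono) (auto simp: emeasure_cball unit_ball_vol_2)
    also have "\<dots> = ennreal (c * (pi * s\<^sup>2 * (l + 1)))"
      using c l by (simp add: algebra_simps flip: ennreal_mult' ennreal_plus)
    also have "\<dots> = 1" using assms l by (simp add: c_def)
    finally have "enn2ereal (\<integral>\<^sup>+w. e2ennreal (log_kernel z w) \<partial>\<mu>) \<le> 1"
      by (simp add: less_eq_ennreal.rep_eq one_ennreal.rep_eq)
    then have "ereal_potential \<mu> z \<le> 1 - 0"
      unfolding ereal_potential_def by (rule ereal_minus_mono) simp
    then show "ereal_potential \<mu> z \<le> 1" by simp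
  qed auto
  ultimately show ?thesis by (simp add: l_def)
qed

section \<open>The potential of a positive measure near an isolated point of its support\<close>

lemma measure_of_borel_cong:
  fixes N :: "complex measure"
  assumes "sets N = sets borel" "\<And>E. E \<in> sets borel \<Longrightarrow> f E = emeasure N E"
  shows "measure_of UNIV (sets borel) f = N"
proof -
  have [simp]: "space N = UNIV" using sets_eq_imp_space_eq[OF assms(1)] by simp
  have "measure_of UNIV (sets borel) f = measure_of UNIV (sets borel) (emeasure N)"
    using assms(2) sets.sigma_sets_eq[of "borel :: complex measure"] by (intro measure_of_eq) auto
  also have "\<dots> = N" using measure_of_of_measure[of N] assms(1) by simp
  finally show ?thesis .
qed

text \<open>For a positive finite measure the Jordan decomposition is trivial, so that the potential is a
  single integral.\<close>

context
  fixes N :: "complex measure"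
  assumes sets_N: "sets N = sets borel" and finite_N: "finite_measure N"
begin

lemma signed_borel_measure_measure: "signed_borel_measure (measure N)"
  using finite_measure.finite_measure_UNION[OF finite_N]
  by (auto simp: signed_borel_measure_def sets_N)

lemma pos_variation_measure: "pos_variation (measure N) = N"
  unfolding pos_variation_def
proof (rule measure_of_borel_cong[OF sets_N])
  fix E :: "complex set" assume E: "E \<in> sets borel"
  show "(SUP A\<in>{A \<in> sets borel. A \<subseteq> E}. ennreal (measure N A)) = emeasure N E"
  proof (rule antisym)
    show "(SUP A\<in>{A \<in> sets borel. A \<subseteq> E}. ennreal (measure N A)) \<le> emeasure N E"
      using E by (auto intro!: SUP_least emeasure_mono
          simp: finite_measure.emeasure_eq_measure[OF finite_N, symmetric] sets_N)
    show "emeasure N E \<le> (SUP A\<in>{A \<in> sets borel. A \<subseteq> E}. ennreal (measure N A))"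
      using E by (intro SUP_upper2[of E]) (auto simp: finite_measure.emeasure_eq_measure[OF finite_N])
  qed
qed

lemma neg_variation_measure: "neg_variation (measure N) = null_measure borel"
  unfolding neg_variation_def pos_variation_def
proof (rule measure_of_borel_cong)
  fix E :: "complex set" assume "E \<in> sets borel"
  have "(SUP A\<in>{A \<in> sets borel. A \<subseteq> E}. ennreal (- measure N A)) \<le> 0"
    by (intro SUP_least) (simp add: ennreal_neg)
  then show "(SUP A\<in>{A \<in> sets borel. A \<subseteq> E}. ennreal (- measure N A)) = emeasure (null_measure borel) E"
    by simp
qed simp

lemma total_variation_measure: "total_variation (measure N) = N"
  unfolding total_variation_def pos_variation_measure neg_variation_measure
  by (rule measure_of_borel_cong[OF sets_N]) simp

lemma log_potential_measure: "log_potential (measure N) z = (\<integral>w. ln (1 / cmod (z - w)) \<partial>N)"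
proof -
  have "AE w in null_measure (borel :: complex measure). ln (1 / cmod (z - w)) = 0"
    by (rule AE_I[where N = UNIV]) auto
  then have "(\<integral>w. ln (1 / cmod (z - w)) \<partial>null_measure borel) = 0"
    by (rule integral_eq_zero_AE)
  then show ?thesis
    by (simp add: log_potential_def pos_variation_measure neg_variation_measure)
qed

text \<open>From here on \<open>p\<close> is isolated in the support: no other mass lies in \<open>ball p e\<close>. Near \<open>p\<close> the
  potential is then the logarithmic pole of the atom plus a bounded function, and it is defined
  there everywhere except possibly at \<open>p\<close>.\<close>

context
  fixes p :: complex and e R :: real
  assumes e: "0 < e" and isolated: "emeasure N (ball p e - {p}) = 0"
    and R: "1 \<le> R" and p: "cmod p \<le> R" and support: "emeasure N (- cball 0 R) = 0"
begin

lemma AE_far: "AE w in N. w = p \<or> (e \<le> dist p w \<and> cmod w \<le> R)"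
proof -
  have "ball p e - {p} \<in> null_sets N" "- cball 0 R \<in> null_sets N"
    using isolated support by (auto simp: null_sets_def sets_N)
  then have "(ball p e - {p}) \<union> - cball 0 R \<in> null_sets N" by (rule null_sets.Un)
  then show ?thesis by (rule AE_I') (use p in \<open>auto simp: not_less\<close>)
qed

lemma AE_ln_bounded:
  assumes "x \<in> ball p (min (e/2) 1)" "x \<noteq> p"
  shows "AE w in N. w \<noteq> x \<and> \<bar>ln (1 / cmod (x - w))\<bar>
    \<le> \<bar>ln (cmod (x - p))\<bar> + \<bar>ln (e/2)\<bar> + ln (2 * R + 1)"
  using AE_far
proof eventually_elim
  case (elim w)
  have x: "dist p x < e/2" "dist p x < 1" using assms by auto
  have xn: "cmod x \<le> R + 1"
    using x p norm_triangle_ineq[of p "x - p"] by (simp add: dist_norm norm_minus_commute)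
  have lnR: "0 \<le> ln (2 * R + 1)" using R by simp
  show ?case
  proof (cases "w = p")
    case True
    then show ?thesis using assms lnR by (simp add: ln_div)
  next
    case False
    then have w: "e \<le> dist p w" "cmod w \<le> R" using elim by auto
    then have lo: "e/2 \<le> cmod (x - w)"
      using x dist_triangle[of p w x] by (simp add: dist_norm)
    have hi: "cmod (x - w) \<le> 2 * R + 1"
      using xn w norm_triangle_ineq4[of x w] by simp
    have pos: "0 < cmod (x - w)" using lo e by linarith
    have "ln (e/2) \<le> ln (cmod (x - w))" "ln (cmod (x - w)) \<le> ln (2 * R + 1)"
      using lo hi e pos R by (auto simp: ln_le_cancel_iff)
    then show ?thesis using pos lnR by (auto simp: ln_div)
  qed
qed

lemma near_atom_in_potential_domain:
  assumes "x \<in> ball p (min (e/2) 1)" "x \<noteq> p"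
  shows "x \<in> potential_domain (measure N)"
proof -
  define B where "B = \<bar>ln (cmod (x - p))\<bar> + \<bar>ln (e/2)\<bar> + ln (2 * R + 1)"
  have "(\<integral>\<^sup>+w. e2ennreal \<bar>log_kernel x w\<bar> \<partial>N) \<le> (\<integral>\<^sup>+w. ennreal B \<partial>N)"
    using AE_ln_bounded[OF assms]
    by (intro nn_integral_mono_AE, eventually_elim) (auto simp: log_kernel_def B_def intro!: ennreal_leI)
  also have "\<dots> < \<infinity>"
    using finite_measure.emeasure_finite[OF finite_N]
    by (simp add: ennreal_mult_less_top less_top)
  finally show ?thesis by (simp add: potential_domain_def total_variation_measure)
qed

lemma log_potential_near_atom:
  assumes "x \<in> ball p (min (e/2) 1)" "x \<noteq> p"
  shows "measure N {p} * ln (1 / cmod (x - p)) - ln (2 * R + 1) * measure N (space N)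
    \<le> log_potential (measure N) x"
proof -
  interpret finite_measure N by (rule finite_N)
  define L where "L = ln (1 / cmod (x - p))"
  have "cmod (x - p) < 1" "0 < cmod (x - p)" using assms by (auto simp: dist_norm norm_minus_commute)
  then have L: "0 \<le> L" by (simp add: L_def)
  have lnR: "0 \<le> ln (2 * R + 1)" using R by simp
  have int: "integrable N (\<lambda>w. ln (1 / cmod (x - w)))"
  proof (rule integrable_const_bound)
    show "AE w in N. norm (ln (1 / cmod (x - w)))
        \<le> \<bar>ln (cmod (x - p))\<bar> + \<bar>ln (e/2)\<bar> + ln (2 * R + 1)"
      using AE_ln_bounded[OF assms] by eventually_elim auto
    show "(\<lambda>w. ln (1 / cmod (x - w))) \<in> borel_measurable N"
      unfolding measurable_cong_sets[OF sets_N refl] by measurable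
  qed
  have pN: "{p} \<in> sets N" by (simp add: sets_N)
  have int': "integrable N (\<lambda>w. L * indicator {p} w - ln (2 * R + 1))"
    using pN by (intro Bochner_Integration.integrable_diff integrable_mult_right integrable_const
        integrable_real_indicator) (auto simp: less_top[symmetric] emeasure_eq_measure)
  have "measure N {p} * L - ln (2 * R + 1) * measure N (space N)
      = (\<integral>w. L * indicator {p} w - ln (2 * R + 1) \<partial>N)"
    using pN by (subst Bochner_Integration.integral_diff)
      (auto simp: emeasure_eq_measure mult.commute intro!: integrable_mult_right integrable_real_indicator)
  also have "\<dots> \<le> (\<integral>w. ln (1 / cmod (x - w)) \<partial>N)"
  proof (rule integral_mono_AE[OF int' int], use AE_far in eventually_elim)
    fix w assume w: "w = p \<or> e \<le> dist p w \<and> cmod w \<le> R"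
    show "L * indicator {p} w - ln (2 * R + 1) \<le> ln (1 / cmod (x - w))"
    proof (cases "w = p")
      case True
      then show ?thesis using lnR by (simp add: L_def)
    next
      case False
      have x: "dist p x < e/2" "dist p x < 1" using assms by auto
      have "cmod x \<le> R + 1"
        using x p norm_triangle_ineq[of p "x - p"] by (simp add: dist_norm norm_minus_commute)
      then have "cmod (x - w) \<le> 2 * R + 1"
        using w False norm_triangle_ineq4[of x w] by simp
      moreover have "0 < cmod (x - w)"
        using w False x e by auto
      ultimately have "ln (cmod (x - w)) \<le> ln (2 * R + 1)"
        using R by (subst ln_le_cancel_iff) auto
      then show ?thesis using False \<open>0 < cmod (x - w)\<close> by (simp add: ln_div)
    qed
  qed
  finally show ?thesis by (simp add: log_potential_measure L_def)
qed

text \<open>Subtracting a constant and a linear function changes \<open>u\<close> only by a bounded amount \<open>H\<close> on the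
  disc, so for large \<open>t\<close> the set contains a small disc near \<open>p\<close> of radius comparable with
  \<open>exp (- t / m)\<close>. Its capacity is about \<open>m / t\<close>, and the product with \<open>t\<close> tends to \<open>m\<close>. Half of that
  limit is reached at a finite \<open>t\<close>.\<close>

lemma weak_capacity_size_near_atom:
  assumes m: "0 < m" "m \<le> measure N {p}" and r: "dist a p < r"
  shows "ennreal (m / 2) \<le> (SUP t \<in> {0<..}. ennreal t * capacity {x \<in> ball a r \<inter> potential_domain (measure N).
     \<bar>log_potential (measure N) x - log_potential (measure N) a
       - (A1 * (Re x - Re a) + A2 * (Im x - Im a))\<bar> > t})"
proof -
  define u where "u = log_potential (measure N)"
  define D where "D = potential_domain (measure N)"
  define \<rho> where "\<rho> = min (min (e/2) 1) (r - dist a p)"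
  have \<rho>: "0 < \<rho>" "\<rho> \<le> 1" using e r by (auto simp: \<rho>_def)
  define H where "H = ln (2 * R + 1) * measure N (space N) + \<bar>u a\<bar> + (\<bar>A1\<bar> + \<bar>A2\<bar>) * r"
  have rpos: "0 \<le> r" using r zero_le_dist[of a p] by linarith
  have H: "0 \<le> H" unfolding H_def using R rpos by (intro add_nonneg_nonneg mult_nonneg_nonneg) auto
  have big: "x \<in> ball a r \<inter> D \<and>
      m * ln (1 / cmod (x - p)) - H \<le> \<bar>u x - u a - (A1 * (Re x - Re a) + A2 * (Im x - Im a))\<bar>"
    if x: "dist p x < \<rho>" "x \<noteq> p" for x
  proof -
    have xb: "x \<in> ball p (min (e/2) 1)" using x by (auto simp: \<rho>_def)
    have xa: "dist a x < r" using x dist_triangle[of a x p] by (auto simp: \<rho>_def)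
    then have "\<bar>Re x - Re a\<bar> \<le> r" "\<bar>Im x - Im a\<bar> \<le> r"
      using abs_Re_le_cmod[of "x - a"] abs_Im_le_cmod[of "x - a"]
      by (auto simp: dist_norm norm_minus_commute)
    then have "\<bar>A1 * (Re x - Re a)\<bar> \<le> \<bar>A1\<bar> * r" "\<bar>A2 * (Im x - Im a)\<bar> \<le> \<bar>A2\<bar> * r"
      by (auto simp: abs_mult intro!: mult_left_mono)
    then have lin: "\<bar>A1 * (Re x - Re a) + A2 * (Im x - Im a)\<bar> \<le> (\<bar>A1\<bar> + \<bar>A2\<bar>) * r"
      by (simp add: algebra_simps)
    have "0 < cmod (x - p)" "cmod (x - p) < 1" using xb x by (auto simp: dist_norm norm_minus_commute)
    then have "0 \<le> ln (1 / cmod (x - p))" by simp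
    then have "m * ln (1 / cmod (x - p)) \<le> measure N {p} * ln (1 / cmod (x - p))"
      using m by (intro mult_right_mono)
    then have "m * ln (1 / cmod (x - p)) - ln (2 * R + 1) * measure N (space N) \<le> u x"
      using log_potential_near_atom[OF xb x(2)] by (simp add: u_def)
    then have "m * ln (1 / cmod (x - p)) - H \<le> \<bar>u x - u a - (A1 * (Re x - Re a) + A2 * (Im x - Im a))\<bar>"
      using lin unfolding H_def by linarith
    then show ?thesis using xa near_atom_in_potential_domain[OF xb x(2)] by (simp add: D_def)
  qed
  \<comment> \<open>chosen so that the capacity of the disc \<open>E\<close> below is at least \<open>m / (t + H')\<close>\<close>
  define H' where "H' = H + 1 + m * (ln 4 + 1)"
  have H': "0 < H'" unfolding H'_def using H m by (intro add_nonneg_pos add_pos_pos mult_pos_pos) auto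
  define t where "t = max H' (m * ln (1 / \<rho>))"
  have t: "0 < t" "H' \<le> t" "m * ln (1 / \<rho>) \<le> t" using H' by (auto simp: t_def)
  define s where "s = exp (- (t + H + 1) / m)"
  have s: "0 < s" by (simp add: s_def)
  have lns: "ln (1 / s) = (t + H + 1) / m"
    using m by (simp add: s_def ln_div field_simps)
  have "s < \<rho>"
  proof -
    have "m * ln (1 / \<rho>) < t + H + 1" using t H by simp
    then have "ln (1 / \<rho>) < ln (1 / s)" unfolding lns using m by (simp add: pos_less_divide_eq mult.commute)
    then show ?thesis using s \<rho> by (simp add: ln_div)
  qed
  \<comment> \<open>the centre is moved off \<open>p\<close>, because \<open>p\<close> itself is outside the domain\<close>
  define E where "E = cball (p + complex_of_real (s/2)) (s/4)"
  have E: "E \<subseteq> {x \<in> ball a r \<inter> D. \<bar>u x - u a - (A1 * (Re x - Re a) + A2 * (Im x - Im a))\<bar> > t}"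
  proof
    fix x assume "x \<in> E"
    then have "cmod (p + complex_of_real (s/2) - x) \<le> s/4" by (simp add: E_def dist_norm)
    moreover have "cmod (complex_of_real (s/2)) = s/2" using s by (simp only: norm_of_real)
    moreover have "cmod (complex_of_real (s/2)) \<le> cmod (p + complex_of_real (s/2) - x) + cmod (x - p)"
      using norm_triangle_ineq[of "p + complex_of_real (s/2) - x" "x - p"] by simp
    moreover have "cmod (x - p) \<le> cmod (complex_of_real (s/2)) + cmod (p + complex_of_real (s/2) - x)"
      using norm_triangle_ineq4[of "complex_of_real (s/2)" "p + complex_of_real (s/2) - x"] by simp
    ultimately have x: "0 < cmod (x - p)" "cmod (x - p) < s" using s by linarith+
    then have "dist p x < \<rho>" "x \<noteq> p" using \<open>s < \<rho>\<close> by (auto simp: dist_norm norm_minus_commute)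
    note b = big[OF this]
    have "ln (1 / s) < ln (1 / cmod (x - p))" using x s by (simp add: ln_div)
    then have "m * ln (1 / s) < m * ln (1 / cmod (x - p))" using m by simp
    then have "t + H + 1 < m * ln (1 / cmod (x - p))" unfolding lns using m by simp
    then show "x \<in> {x \<in> ball a r \<inter> D. \<bar>u x - u a - (A1 * (Re x - Re a) + A2 * (Im x - Im a))\<bar> > t}"
      using b by auto
  qed
  have "s/4 < 1" "0 < s/4" using s \<open>s < \<rho>\<close> \<rho> by auto
  then have "ennreal (1 / (ln (1 / (s/4)) + 1)) \<le> compact_capacity E"
    unfolding E_def by (intro compact_capacity_cball_ge)
  also have "\<dots> \<le> capacity {x \<in> ball a r \<inter> D. \<bar>u x - u a - (A1 * (Re x - Re a) + A2 * (Im x - Im a))\<bar> > t}"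
    using E by (intro le_capacity) (auto simp: E_def)
  finally have cap: "ennreal (1 / (ln (1 / (s/4)) + 1)) \<le> \<dots>" .
  have "ln (1 / (s/4)) = ln 4 + ln (1 / s)" using s by (simp add: ln_div)
  then have denom: "ln (1 / (s/4)) + 1 = (t + H') / m"
    unfolding lns H'_def using m by (simp add: field_simps)
  have "m / 2 \<le> t * (1 / (ln (1 / (s/4)) + 1))"
    unfolding denom using m t H' by (simp add: field_simps)
  then have "ennreal (m / 2) \<le> ennreal t * ennreal (1 / (ln (1 / (s/4)) + 1))"
    using t by (simp add: ennreal_leI flip: ennreal_mult')
  also have "\<dots> \<le> ennreal t * capacity {x \<in> ball a r \<inter> D. \<bar>u x - u a - (A1 * (Re x - Re a) + A2 * (Im x - Im a))\<bar> > t}"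
    using cap by (rule mult_left_mono) simp
  also have "\<dots> \<le> (SUP t \<in> {0<..}. ennreal t * capacity {x \<in> ball a r \<inter> D.
     \<bar>u x - u a - (A1 * (Re x - Re a) + A2 * (Im x - Im a))\<bar> > t})"
    using t by (intro SUP_upper) auto
  finally show ?thesis by (simp add: u_def D_def)
qed

end

end

section \<open>Measures with atoms near every point of a compact set\<close>

lemma ennreal_divide_ge:
  fixes X Y :: ennreal
  assumes "ennreal x \<le> X" "Y \<le> ennreal y" "0 \<le> x" "0 < y"
  shows "ennreal (x / y) \<le> X / Y"
proof -
  have "inverse (ennreal y) \<le> inverse Y"
  proof (cases Y)
    case (real v)
    then show ?thesis
      using assms by (cases "v = 0") (auto simp: inverse_ennreal ennreal_le_iff intro!: ennreal_leI)
  qed (use assms in \<open>auto simp: top_unique\<close>)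
  with assms have "ennreal x * inverse (ennreal y) \<le> X * inverse Y" by (intro mult_mono) auto
  then show ?thesis using assms by (simp add: divide_ennreal divide_ennreal_def[symmetric])
qed

text \<open>The mass \<open>phi r\<close> is exactly \<open>r\<close> times the upper bound for the capacity of \<open>ball a r\<close>, so the
  quotient in the definition stays at least \<open>1/2\<close> along the radii \<open>R n\<close>, whichever linear function
  is subtracted.\<close>

lemma not_weak_capacity_differentiable:
  assumes R: "\<And>n. 0 < R n" "\<And>n. R n \<le> exp (-1)" "R \<longlonglongrightarrow> 0"
    and size: "\<And>n A1 A2. ennreal (phi (R n) / 2) \<le> (SUP t \<in> {0<..}. ennreal t *
        capacity {x \<in> ball a (R n) \<inter> D. \<bar>u x - u a - (A1 * (Re x - Re a) + A2 * (Im x - Im a))\<bar> > t})"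
  shows "\<not> weak_capacity_differentiable D u a"
proof
  assume "weak_capacity_differentiable D u a"
  then obtain A1 A2 where lim:
    "((\<lambda>r. (SUP t \<in> {0<..}. ennreal t * capacity {x \<in> ball a r \<inter> D.
                  \<bar>u x - u a - (A1 * (Re x - Re a) + A2 * (Im x - Im a))\<bar> > t})
              / (ennreal r * capacity (ball a r))) \<longlongrightarrow> 0) (at_right 0)" (is "(?F \<longlongrightarrow> 0) _")
    unfolding weak_capacity_differentiable_def by blast
  have "filterlim R (at_right 0) sequentially"
    using R by (simp add: filterlim_at less_imp_neq[THEN not_sym])
  with lim have lim': "(\<lambda>n. ?F (R n)) \<longlonglongrightarrow> 0" by (rule filterlim_compose)
  have "ennreal (1/2) \<le> ?F (R n)" for n
  proof -
    have "R n < 1" using R(2)[of n] by (rule le_less_trans) simp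
    then have l: "0 < ln (1 / R n)" using R by simp
    have "ennreal (R n) * capacity (ball a (R n)) \<le> ennreal (R n) * ennreal (1 / ln (1 / R n))"
      using R \<open>R n < 1\<close> by (intro mult_left_mono capacity_ball_le) auto
    also have "\<dots> = ennreal (phi (R n))"
      using R(1,2)[of n] l by (simp add: phi_def flip: ennreal_mult')
    finally have "ennreal (R n) * capacity (ball a (R n)) \<le> ennreal (phi (R n))" .
    moreover have "0 < phi (R n)" using R(1,2)[of n] l by (simp add: phi_def)
    ultimately have "ennreal (phi (R n) / 2 / phi (R n)) \<le> ?F (R n)"
      by (intro ennreal_divide_ge size) auto
    then show ?thesis using \<open>0 < phi (R n)\<close> by simp
  qed
  then have "ennreal (1/2) \<le> 0" by (intro tendsto_lowerbound[OF lim']) auto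
  then show False by simp
qed

text \<open>Mass \<open>m n\<close> at each point of \<open>G n\<close>, for every \<open>n\<close>; multiplicities add up.\<close>

definition atomic_measure :: "(nat \<Rightarrow> real) \<Rightarrow> (nat \<Rightarrow> complex set) \<Rightarrow> complex measure" where
  "atomic_measure m G = distr
     (density (count_space UNIV) (\<lambda>z. \<Sum>n. ennreal (m n) * indicator (G n) z)) borel (\<lambda>z. z)"

lemma sets_atomic_measure: "sets (atomic_measure m G) = sets borel"
  by (simp add: atomic_measure_def)

lemma emeasure_atomic_measure:
  assumes "A \<in> sets borel"
  shows "emeasure (atomic_measure m G) A = (\<Sum>n. ennreal (m n) * emeasure (count_space UNIV) (G n \<inter> A))"
proof -
  have "emeasure (atomic_measure m G) A
      = (\<integral>\<^sup>+z. (\<Sum>n. ennreal (m n) * indicator (G n) z) * indicator A z \<partial>count_space UNIV)"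
    unfolding atomic_measure_def using assms
    by (subst emeasure_distr) (auto simp: emeasure_density)
  also have "\<dots> = (\<integral>\<^sup>+z. (\<Sum>n. ennreal (m n) * indicator (G n \<inter> A) z) \<partial>count_space UNIV)"
    by (intro nn_integral_cong) (auto simp: indicator_def)
  also have "\<dots> = (\<Sum>n. \<integral>\<^sup>+z. ennreal (m n) * indicator (G n \<inter> A) z \<partial>count_space UNIV)"
    by (intro nn_integral_suminf) auto
  also have "\<dots> = (\<Sum>n. ennreal (m n) * emeasure (count_space UNIV) (G n \<inter> A))"
    by (intro suminf_cong) (simp add: nn_integral_cmult_indicator)
  finally show ?thesis .
qed

text \<open>Put an atom of mass \<open>phi (R n)\<close> at each point of \<open>G n\<close>. As the sets \<open>G n\<close> are finite and
  approach \<open>K\<close>, the atoms accumulate only at \<open>K\<close>; as they avoid \<open>K\<close>, each of them is isolated. Every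
  point of \<open>K\<close> sees an atom of mass \<open>phi (R n)\<close> within distance \<open>R n\<close>, for every \<open>n\<close>.\<close>

lemma exists_nowhere_differentiable_potential:
  assumes K: "compact K"
    and G: "\<And>n. finite (G n)" "\<And>n. G n \<inter> K = {}"
    and near: "\<And>n g. g \<in> G n \<Longrightarrow> \<exists>a\<in>K. dist a g < R n"
    and net: "\<And>n a. a \<in> K \<Longrightarrow> \<exists>g\<in>G n. dist a g < R n"
    and R: "\<And>n. 0 < R n" "\<And>n. R n \<le> exp (-1)" "R \<longlonglongrightarrow> 0"
    and mass: "summable (\<lambda>n. real (card (G n)) * phi (R n))"
  obtains \<nu> where "signed_borel_measure \<nu>"
    "integrable (total_variation \<nu>) (\<lambda>w. ln (1 + cmod w))"
    "\<And>a. a \<in> K \<Longrightarrow> \<not> weak_capacity_differentiable (potential_domain \<nu>) (log_potential \<nu>) a"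
proof -
  define N where "N = atomic_measure (\<lambda>n. phi (R n)) G"
  have sets_N: "sets N = sets borel" by (simp add: N_def sets_atomic_measure)
  have R1: "R n < 1" for n using R(2)[of n] by (rule le_less_trans) simp
  have phi_pos: "0 < phi (R n)" for n using R1[of n] R(1,2)[of n] by (simp add: phi_def)
  have finite_N: "finite_measure N"
  proof (rule finite_measureI)
    have "space N = UNIV" using sets_eq_imp_space_eq[OF sets_N] by simp
    then have "emeasure N (space N) = (\<Sum>n. ennreal (real (card (G n)) * phi (R n)))"
      unfolding N_def using G phi_pos
      by (simp add: emeasure_atomic_measure emeasure_count_space_finite mult.commute ennreal_mult
          ennreal_of_nat_eq_real_of_nat less_imp_le)
    also have "\<dots> \<noteq> \<infinity>" using mass phi_pos
      by (simp add: ennreal_suminf_neq_top less_imp_le)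
    finally show "emeasure N (space N) \<noteq> \<infinity>" .
  qed
  interpret finite_measure N by (rule finite_N)
  have null: "emeasure N A = 0" if "A \<in> sets borel" "\<And>n. G n \<inter> A = {}" for A
    unfolding N_def using that by (simp add: emeasure_atomic_measure)
  have atom: "phi (R n) \<le> measure N {p}" if "p \<in> G n" for n p
  proof -
    have "ennreal (phi (R n)) = (\<Sum>k\<in>{n}. ennreal (phi (R k)) * emeasure (count_space UNIV) (G k \<inter> {p}))"
      using that by (simp add: emeasure_count_space_finite Int_absorb1)
    also have "\<dots> \<le> (\<Sum>k. ennreal (phi (R k)) * emeasure (count_space UNIV) (G k \<inter> {p}))"
      by (intro sum_le_suminf) auto
    also have "\<dots> = emeasure N {p}" by (simp add: N_def emeasure_atomic_measure)
    finally show ?thesis by (simp add: emeasure_eq_measure)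
  qed
  obtain B0 where B0: "\<And>a. a \<in> K \<Longrightarrow> cmod a \<le> B0"
    using compact_imp_bounded[OF K] by (auto simp: bounded_iff)
  define B where "B = max B0 0 + 1"
  have B: "1 \<le> B" by (simp add: B_def)
  have G_le: "cmod p \<le> B" if p: "p \<in> G n" for n p
  proof -
    obtain a where a: "a \<in> K" "dist a p < R n" using near[OF p] by blast
    then have "cmod p \<le> cmod a + dist a p"
      using norm_triangle_ineq[of a "p - a"] by (simp add: dist_norm norm_minus_commute)
    then show ?thesis using a B0[OF a(1)] R1[of n] by (simp add: B_def)
  qed
  have support: "emeasure N (- cball 0 B) = 0"
    using G_le by (intro null) (auto simp: Compl_eq_Diff_UNIV)
  have isolated: "\<exists>e>0. emeasure N (ball p e - {p}) = 0" if p: "p \<in> G n" for n p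
  proof -
    have "p \<in> - K" "open (- K)" using p G(2) K by (auto simp: compact_imp_closed)
    then obtain d where d: "0 < d" "ball p d \<subseteq> - K" by (meson openE)
    have "\<forall>\<^sub>F k in sequentially. R k < d / 2" using R(3) d by (intro order_tendstoD) auto
    then obtain M where M: "\<And>k. M \<le> k \<Longrightarrow> R k < d / 2" by (auto simp: eventually_sequentially)
    obtain \<delta> where \<delta>: "0 < \<delta>" "\<And>g. g \<in> (\<Union>k<M. G k) \<Longrightarrow> g \<noteq> p \<Longrightarrow> \<delta> \<le> dist p g"
      using finite_set_avoid[of "\<Union>k<M. G k" p] G(1) by auto
    define e where "e = min \<delta> (d / 2)"
    have "G k \<inter> (ball p e - {p}) = {}" for k
    proof (rule equals0I)
      fix g assume "g \<in> G k \<inter> (ball p e - {p})"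
      then have g: "g \<in> G k" "g \<noteq> p" "dist p g < \<delta>" "dist p g < d / 2" by (auto simp: e_def)
      show False
      proof (cases "k < M")
        case True
        then show False using \<delta>(2)[of g] g by auto
      next
        case False
        obtain a where a: "a \<in> K" "dist a g < R k" using near[OF g(1)] by blast
        then have "dist p a < d"
          using M[of k] False g(4) dist_triangle[of p a g] by (simp add: dist_commute)
        then show False using d a by auto
      qed
    qed
    then have "emeasure N (ball p e - {p}) = 0" by (intro null) auto
    then show ?thesis using \<delta> d by (intro exI[of _ e]) (simp add: e_def)
  qed
  show ?thesis
  proof (rule that[of "measure N"])
    show "signed_borel_measure (measure N)"
      using sets_N finite_N by (rule signed_borel_measure_measure)
    have "AE w in N. cmod w \<le> B"
      by (rule AE_I'[of "- cball 0 B"]) (use support in \<open>auto simp: null_sets_def sets_N\<close>)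
    then have "AE w in N. norm (ln (1 + cmod w)) \<le> ln (1 + B)"
    proof (rule eventually_mono)
      fix w :: complex assume "cmod w \<le> B"
      then have "ln (1 + cmod w) \<le> ln (1 + B)" using B norm_ge_zero[of w] by (subst ln_le_cancel_iff) linarith+
      then show "norm (ln (1 + cmod w)) \<le> ln (1 + B)" by simp
    qed
    moreover have "(\<lambda>w. ln (1 + cmod w)) \<in> borel_measurable N"
      unfolding measurable_cong_sets[OF sets_N refl] by measurable
    ultimately have "integrable N (\<lambda>w. ln (1 + cmod w))" by (rule integrable_const_bound)
    then show "integrable (total_variation (measure N)) (\<lambda>w. ln (1 + cmod w))"
      by (simp add: total_variation_measure[OF sets_N finite_N])
  next
    fix a assume a: "a \<in> K"
    show "\<not> weak_capacity_differentiable (potential_domain (measure N)) (log_potential (measure N)) a"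
    proof (rule not_weak_capacity_differentiable[OF R])
      fix n A1 A2
      obtain p where p: "p \<in> G n" "dist a p < R n" using net[OF a] by blast
      obtain e where e: "0 < e" "emeasure N (ball p e - {p}) = 0" using isolated[OF p(1)] by blast
      show "ennreal (phi (R n) / 2) \<le> (SUP t \<in> {0<..}. ennreal t *
          capacity {x \<in> ball a (R n) \<inter> potential_domain (measure N).
            \<bar>log_potential (measure N) x - log_potential (measure N) a
              - (A1 * (Re x - Re a) + A2 * (Im x - Im a))\<bar> > t})"
        by (rule weak_capacity_size_near_atom[OF sets_N finite_N e B G_le[OF p(1)] support
              phi_pos atom[OF p(1)] p(2)])
    qed
  qed
qed

section \<open>A staircase function\<close>

lemma mult_ln_inverse_mono:
  fixes s t :: real
  assumes "0 < s" "s \<le> t" "t \<le> exp (-1)"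
  shows "s * ln (1 / s) \<le> t * ln (1 / t)"
proof -
  have t: "0 < t" using assms by simp
  have "ln t \<le> -1" using assms t by (metis ln_exp ln_le_cancel_iff exp_gt_zero)
  then have "(t - s) * 1 \<le> (t - s) * ln (1 / t)"
    using assms t by (intro mult_left_mono) (auto simp: ln_div)
  moreover have "s * ln (t / s) \<le> s * (t / s - 1)"
    using assms t by (intro mult_left_mono ln_le_minus_one) auto
  moreover have "s * ln (1 / s) = s * ln (1 / t) + s * ln (t / s)"
    using assms t by (simp add: ln_div algebra_simps)
  ultimately show ?thesis using assms by (simp add: algebra_simps)
qed

lemma mult_half_power_antimono:
  assumes "1 \<le> j" "j \<le> k"
  shows "real k * (1/2) ^ k \<le> real j * (1/2) ^ j"
  using assms(2)
proof (induction k rule: dec_induct)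
  case (step k)
  have "real (Suc k) * (1/2) ^ Suc k \<le> real k * (1/2) ^ k"
    using step assms by (simp add: field_simps)
  with step show ?case by linarith
qed simp

text \<open>The exponents \<open>q\<close> of the dyadic scales. Later they are chosen to grow so fast that
  \<open>\<Phi> s \<ge> 2 ^ n * phi s\<close> for \<open>s \<le> (1/2) ^ q n\<close>.\<close>

locale staircase =
  fixes q :: "nat \<Rightarrow> nat"
  assumes strict_mono_q: "strict_mono q" and q_ge: "n + 10 \<le> q n"
begin

text \<open>Up to a constant factor, \<open>phi (scale n)\<close> equals \<open>(1/2) ^ n / 4 ^ q n\<close>. So the
  \<open>4 ^ q n\<close> squares of generation \<open>n\<close>, which have side about \<open>scale n\<close>, have total \<open>phi\<close>-size
  about \<open>(1/2) ^ n\<close>, a summable sequence, whereas their total \<open>\<Phi>\<close>-size is bounded below once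
  \<open>\<Phi> \<ge> 2 ^ n * phi\<close> on that scale.\<close>

definition height :: "nat \<Rightarrow> real" where
  "height n = (1/2) ^ n * (real (q n) * (1/2) ^ q n)"

definition scale :: "nat \<Rightarrow> real" where
  "scale n = height n / 2 ^ q n"

text \<open>The staircase jumps by at least \<open>height n / 2 ^ q (Suc n)\<close> at each multiple of
  \<open>1 / 2 ^ q (Suc n)\<close>. It is the inverse of a Cantor function, written as a pure jump function. The
  advantage over digit expansions is that monotonicity and lower bounds for increments can be read
  off term by term.\<close>

definition stair_term :: "nat \<Rightarrow> real \<Rightarrow> real" where
  "stair_term n x = height n / 2 ^ q (Suc n) * \<lfloor>2 ^ q (Suc n) * x\<rfloor>"

definition stair :: "real \<Rightarrow> real" where
  "stair x = (\<Sum>n. stair_term n x)"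

lemma q_pos: "0 < q n"
  using q_ge[of n] by simp

lemma height_pos: "0 < height n"
  using q_pos by (simp add: height_def)

lemma scale_pos: "0 < scale n"
  using height_pos by (simp add: scale_def)

lemma height_decay: "height (n + k) \<le> height n * (1/2) ^ k"
proof -
  have "real (q (n + k)) * (1/2) ^ q (n + k) \<le> real (q n) * (1/2) ^ q n"
    using q_pos[of n] strict_mono_q by (intro mult_half_power_antimono) (auto simp: strict_mono_less_eq)
  then show ?thesis by (simp add: height_def power_add mult_ac)
qed

lemma scale_le: "12 * scale n \<le> (1/2) ^ q n"
proof -
  have exp_bound: "12 * k \<le> 2 ^ k" if "10 \<le> k" for k :: nat
    using that by (induction k rule: dec_induct) auto
  have "real (12 * q n) \<le> real (2 ^ q n)"
    using exp_bound[of "q n"] q_ge[of n] by (intro of_nat_mono) simp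
  then have "12 * (real (q n) * (1/2) ^ q n) \<le> 1" by (simp add: field_simps)
  then have "(1/2) ^ n * (12 * (real (q n) * (1/2) ^ q n)) \<le> 1 * 1"
    by (intro mult_mono) (auto simp: power_le_one)
  then show ?thesis by (simp add: scale_def height_def field_simps)
qed

lemma half_power_q_le: "(1/2 :: real) ^ q n \<le> exp (-1)"
proof -
  have "(1/2 :: real) ^ q n \<le> (1/2) ^ 10"
    using q_ge[of n] by (intro power_decreasing) auto
  also have "\<dots> \<le> 1 / 3" by (simp add: power_divide)
  also have "\<dots> \<le> exp (-1)" using exp_le by (simp add: exp_minus field_simps)
  finally show ?thesis .
qed

lemma stair_term_mono: "x \<le> y \<Longrightarrow> stair_term n x \<le> stair_term n y"
  unfolding stair_term_def using height_pos[of n]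
  by (intro mult_left_mono) (auto intro!: floor_mono)

lemma stair_term_nonneg: "0 \<le> x \<Longrightarrow> 0 \<le> stair_term n x"
  using stair_term_mono[of 0 x n] by (simp add: stair_term_def)

lemma stair_term_le: "stair_term n x \<le> height n * x"
proof -
  have "stair_term n x \<le> height n / 2 ^ q (Suc n) * (2 ^ q (Suc n) * x)"
    unfolding stair_term_def using height_pos[of n] by (intro mult_left_mono) auto
  then show ?thesis by simp
qed

lemma summable_height: "summable height"
proof (rule summable_comparison_test')
  show "summable (\<lambda>n. height 0 * (1/2) ^ n)" by (intro summable_mult summable_geometric) auto
  show "norm (height n) \<le> height 0 * (1/2) ^ n" for n
    using height_decay[of 0 n] height_pos[of n] by simp
qed

lemma summable_stair_term: "0 \<le> x \<Longrightarrow> summable (\<lambda>n. stair_term n x)"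
  using stair_term_le[of _ x] stair_term_nonneg[of x]
  by (intro summable_comparison_test'[OF summable_mult2[OF summable_height, of x]]) auto

lemma stair_diff:
  "0 \<le> x \<Longrightarrow> x \<le> y \<Longrightarrow> stair y - stair x = (\<Sum>n. stair_term n y - stair_term n x)"
  unfolding stair_def by (intro suminf_diff summable_stair_term) auto

lemma stair_term_diff_le:
  assumes "0 \<le> x" "x \<le> y"
  shows "stair_term n y - stair_term n x \<le> stair y - stair x"
proof -
  have "(\<Sum>k\<in>{n}. stair_term k y - stair_term k x) \<le> (\<Sum>k. stair_term k y - stair_term k x)"
    using assms stair_term_mono
    by (intro sum_le_suminf summable_diff summable_stair_term) auto
  then show ?thesis using stair_diff[OF assms] by simp
qed

lemma stair_mono: "0 \<le> x \<Longrightarrow> x \<le> y \<Longrightarrow> stair x \<le> stair y"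
  using stair_term_diff_le[of x y 0] stair_term_mono[of x y 0] by simp

text \<open>An interval of length at least twice the mesh \<open>1 / 2 ^ q (Suc n)\<close> meets at least half of the
  expected number of jumps of generation \<open>n\<close>.\<close>

lemma stair_expand:
  assumes "0 \<le> x" "2 / 2 ^ q (Suc n) \<le> y - x"
  shows "height n * (y - x) / 2 \<le> stair y - stair x"
proof -
  define P :: real where "P = 2 ^ q (Suc n)"
  have P: "P > 0" by (simp add: P_def)
  have xy: "x \<le> y" 
    using assms(2) by (smt (verit) zero_le_divide_iff zero_le_power)
  have "2 \<le> P * (y - x)" using assms(2) P by (simp add: P_def field_simps)
  moreover have half_le: "t / 2 \<le> k" if "2 \<le> t" "t - 1 \<le> k" for t k :: real
    using that by linarith
  moreover have "P * (y - x) - 1 \<le> \<lfloor>P * y\<rfloor> - \<lfloor>P * x\<rfloor>"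
    unfolding right_diff_distrib by linarith
  ultimately have "P * (y - x) / 2 \<le> real_of_int (\<lfloor>P * y\<rfloor> - \<lfloor>P * x\<rfloor>)"
    using half_le unfolding of_int_diff by blast
  then have "height n / P * (P * (y - x) / 2) \<le> height n / P * (\<lfloor>P * y\<rfloor> - \<lfloor>P * x\<rfloor>)"
    using height_pos[of n] P by (intro mult_left_mono) auto
  also have "\<dots> = stair_term n y - stair_term n x"
    by (simp add: stair_term_def P_def algebra_simps)
  also have "\<dots> \<le> stair y - stair x" using assms xy by (intro stair_term_diff_le)
  finally show ?thesis using P by simp
qed

text \<open>Since the meshes divide one another, no jump of a generation below \<open>n\<close> occurs inside a
  dyadic interval of length \<open>1 / 2 ^ q n\<close>; the later generations contribute a geometric series.\<close>

lemma stair_step: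
  assumes "real i / 2 ^ q n \<le> x" "x < (real i + 1) / 2 ^ q n"
  shows "stair x - stair (real i / 2 ^ q n) \<le> 2 * scale n"
proof -
  define y where "y = real i / 2 ^ q n"
  have y: "0 \<le> y" "y \<le> x" using assms by (auto simp: y_def)
  have step: "stair_term m x - stair_term m y \<le> (if n \<le> m then height n / 2 ^ q n * (1/2) ^ (m - n) else 0)" for m
  proof (cases "n \<le> m")
    case True
    then have "q n \<le> q (Suc m)" using strict_mono_q by (simp add: strict_mono_less_eq)
    then have "(2::real) ^ q (Suc m) = 2 ^ (q (Suc m) - q n) * 2 ^ q n"
      by (simp flip: power_add)
    then have Py: "2 ^ q (Suc m) * y = real_of_int (2 ^ (q (Suc m) - q n) * int i)"
      by (simp add: y_def)
    have "\<lfloor>2 ^ q (Suc m) * x\<rfloor> - \<lfloor>2 ^ q (Suc m) * y\<rfloor> \<le> 2 ^ q (Suc m) * (x - y)"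
      unfolding Py floor_of_int right_diff_distrib using of_int_floor_le by simp
    also have "\<dots> \<le> 2 ^ q (Suc m) * (1 / 2 ^ q n)"
      using assms by (intro mult_left_mono) (auto simp: y_def add_divide_distrib)
    finally have "height m / 2 ^ q (Suc m) * (\<lfloor>2 ^ q (Suc m) * x\<rfloor> - \<lfloor>2 ^ q (Suc m) * y\<rfloor>)
        \<le> height m / 2 ^ q (Suc m) * (2 ^ q (Suc m) * (1 / 2 ^ q n))"
      using height_pos[of m] by (intro mult_left_mono) auto
    then have "stair_term m x - stair_term m y \<le> height m / 2 ^ q n"
      by (simp add: stair_term_def algebra_simps)
    also have "\<dots> \<le> height n * (1/2) ^ (m - n) / 2 ^ q n"
      using height_decay[of n "m - n"] True by (intro divide_right_mono) auto
    finally show ?thesis using True by simp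
  next
    case False
    then have "q (Suc m) \<le> q n" using strict_mono_q by (simp add: strict_mono_less_eq)
    then have Pn: "(2::real) ^ q n = 2 ^ (q n - q (Suc m)) * 2 ^ q (Suc m)"
      by (simp flip: power_add)
    define d :: nat where "d = 2 ^ (q n - q (Suc m))"
    have d: "0 < d" by (simp add: d_def)
    have Pn': "2 ^ q n = real d * 2 ^ q (Suc m)" by (simp add: Pn d_def)
    have "\<lfloor>2 ^ q (Suc m) * x\<rfloor> = \<lfloor>2 ^ q (Suc m) * y\<rfloor>"
    proof -
      have y_eq: "2 ^ q (Suc m) * y = real i / real d" by (simp add: y_def Pn')
      have fl: "\<lfloor>real i / real d\<rfloor> = int (i div d)" by (simp add: floor_divide_of_nat_eq)
      have "2 ^ q (Suc m) * x < (real i + 1) / real d"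
        using assms(2) d by (simp add: Pn' field_simps)
      also have "\<dots> \<le> real (i div d) + 1"
      proof -
        have "i + 1 \<le> (i div d + 1) * d"
          using d by (simp add: Suc_le_eq) (metis add.commute dividend_less_div_times mult.commute)
        then have "real (i + 1) \<le> real ((i div d + 1) * d)" by (rule of_nat_mono)
        then show ?thesis using d by (simp add: field_simps)
      qed
      finally have "2 ^ q (Suc m) * x < real (i div d) + 1" .
      moreover have "real (i div d) \<le> 2 ^ q (Suc m) * x"
      proof -
        have "real (i div d) \<le> real i / real d" by (rule of_nat_div_le_of_nat)
        also have "\<dots> \<le> 2 ^ q (Suc m) * x"
          unfolding y_eq[symmetric] using y by (intro mult_left_mono) auto
        finally show ?thesis .
      qed
      ultimately have "\<lfloor>2 ^ q (Suc m) * x\<rfloor> = int (i div d)" by (simp add: floor_unique)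
      then show ?thesis using fl y_eq by simp
    qed
    then show ?thesis using False by (simp add: stair_term_def)
  qed
  have sums: "(\<lambda>m. if n \<le> m then height n / 2 ^ q n * (1/2) ^ (m - n) else 0) sums (height n / 2 ^ q n * 2)"
  proof -
    have "(\<lambda>m. height n / 2 ^ q n * (1/2) ^ m) sums (height n / 2 ^ q n * 2)"
      using geometric_sums[of "1/2 :: real"] by (intro sums_mult) simp
    then show ?thesis
      by (subst sums_iff_shift'[symmetric, where n = n]) auto
  qed
  have "stair x - stair y = (\<Sum>m. stair_term m x - stair_term m y)" using y by (intro stair_diff)
  also have "\<dots> \<le> (\<Sum>m. if n \<le> m then height n / 2 ^ q n * (1/2) ^ (m - n) else 0)"
    using y step sums by (intro suminf_le summable_diff summable_stair_term) (auto simp: sums_iff)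
  also have "\<dots> = 2 * scale n" using sums by (simp add: sums_iff scale_def)
  finally show ?thesis by (simp add: y_def)
qed

text \<open>The factor \<open>12\<close> is the ratio between the scale and the radii at which the atoms are placed
  below.\<close>

lemma phi_scale_le: "4 ^ q n * phi (12 * scale n) \<le> 24 * (1/2) ^ n"
proof -
  have small: "12 * scale n \<le> exp (-1)"
    using scale_le[of n] half_power_q_le[of n] by linarith
  have "ln (12 * scale n) \<le> ln ((1/2) ^ q n)"
    using scale_le[of n] scale_pos[of n] by (subst ln_le_cancel_iff) auto
  also have "\<dots> = - (real (q n) * ln 2)" by (simp add: ln_realpow ln_div)
  finally have "real (q n) * ln 2 \<le> ln (1 / (12 * scale n))"
    using scale_pos[of n] by (simp add: ln_div)
  moreover have "real (q n) * (1/2) \<le> real (q n) * ln 2"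
    using ln2_ge_two_thirds by (intro mult_left_mono) auto
  ultimately have ln: "real (q n) / 2 \<le> ln (1 / (12 * scale n))" by simp
  have "phi (12 * scale n) = 12 * scale n / ln (1 / (12 * scale n))"
    using small by (simp add: phi_def)
  also have "\<dots> \<le> 12 * scale n / (real (q n) / 2)"
    using ln scale_pos[of n] q_pos[of n] by (intro divide_left_mono mult_pos_pos) linarith+
  also have "\<dots> = 24 * (1/2) ^ n / 4 ^ q n"
  proof -
    have "(4::real) ^ q n = 2 ^ q n * 2 ^ q n" by (simp flip: power_mult_distrib)
    then show ?thesis using q_pos[of n] by (simp add: scale_def height_def field_simps)
  qed
  finally show ?thesis by (simp add: field_simps)
qed

text \<open>Write \<open>s = height n * d / 2\<close>. Then \<open>phi s / s\<^sup>2 = 1 / (s * ln (1 / s))\<close> decreases in \<open>s\<close>, so the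
  worst case is the right end \<open>s = scale n\<close> of the range, where both sides are comparable by the
  choice of the heights.\<close>

lemma phi_stair_scale:
  assumes "0 < d" "d < 2 / 2 ^ q n"
  shows "d\<^sup>2 \<le> 12 * 2 ^ n * phi (height n * d / 2)"
proof -
  define s where "s = height n * d / 2"
  have s: "0 < s" using assms height_pos[of n] by (simp add: s_def)
  have "height n * d \<le> height n * (2 / 2 ^ q n)"
    using assms height_pos[of n] by (intro mult_left_mono) auto
  then have s_le: "s \<le> scale n" by (simp add: s_def scale_def)
  have small: "scale n \<le> exp (-1)"
    using scale_le[of n] scale_pos[of n] half_power_q_le[of n] by linarith
  have "(1/2) ^ (3 * q n) \<le> scale n"
  proof -
    have "(1/2 :: real) ^ (3 * q n) \<le> (1/2) ^ (n + q n + q n)"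
      using q_ge[of n] by (intro power_decreasing) auto
    also have "\<dots> \<le> real (q n) * (1/2) ^ (n + q n + q n)"
      using q_pos[of n] by (simp add: Suc_le_eq)
    also have "\<dots> = scale n" by (simp add: scale_def height_def power_add power_divide)
    finally show ?thesis .
  qed
  then have "ln ((1/2) ^ (3 * q n)) \<le> ln (scale n)"
    using scale_pos[of n] by (subst ln_le_cancel_iff) auto
  moreover have "ln ((1/2 :: real) ^ (3 * q n)) = - (3 * real (q n) * ln 2)"
    by (simp add: ln_realpow ln_div)
  moreover have "3 * real (q n) * ln 2 \<le> 3 * real (q n) * 1"
    using ln2_le_25_over_36 by (intro mult_left_mono) auto
  ultimately have ln: "ln (1 / scale n) \<le> 3 * real (q n)"
    using scale_pos[of n] by (simp add: ln_div)
  have "s * ln (1 / s) \<le> scale n * ln (1 / scale n)"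
    using s s_le small by (rule mult_ln_inverse_mono)
  also have "\<dots> \<le> scale n * (3 * real (q n))"
    using ln scale_pos[of n] by (intro mult_left_mono) auto
  finally have up: "s * ln (1 / s) \<le> scale n * (3 * real (q n))" .
  have "s \<le> exp (-1)" using s_le small by simp
  also have "exp (-1) < (1::real)" by simp
  finally have pos: "0 < s * ln (1 / s)" using s by (simp add: ln_div mult_pos_neg)
  have "d\<^sup>2 = 12 * 2 ^ n * (s\<^sup>2 / (scale n * (3 * real (q n))))"
    using q_pos[of n] by (simp add: s_def scale_def height_def field_simps power2_eq_square)
  also have "\<dots> \<le> 12 * 2 ^ n * (s\<^sup>2 / (s * ln (1 / s)))"
    using up pos scale_pos[of n] q_pos[of n] by (intro mult_left_mono divide_left_mono) auto
  also have "s\<^sup>2 / (s * ln (1 / s)) = phi s"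
    using s \<open>s \<le> exp (-1)\<close> by (simp add: phi_def power2_eq_square)
  finally show ?thesis by (simp add: s_def)
qed

text \<open>The estimate for the mass distribution, in one coordinate: points whose images are close must
  themselves be close. The argument uses the least \<open>n\<close> for which the mesh \<open>1 / 2 ^ q (Suc n)\<close>
  is at most half of \<open>y - x\<close>; the condition on \<open>scale 0\<close> excludes that already the mesh \<open>1 / 2 ^ q 0\<close>
  is that small.\<close>

lemma square_le_gauge_stair_diff:
  assumes \<Phi>: "\<And>n s. 0 < s \<Longrightarrow> s \<le> (1/2) ^ q n \<Longrightarrow> 2 ^ n * phi s \<le> \<Phi> s"
    and mono: "strict_mono_on {0..} \<Phi>"
    and "0 \<le> x" "x < y" "stair y - stair x < scale 0"
  shows "(y - x)\<^sup>2 \<le> 12 * \<Phi> (stair y - stair x)"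
proof -
  define d where "d = y - x"
  have d: "0 < d" using assms by (simp add: d_def)
  have "\<exists>n. 2 / 2 ^ q (Suc n) \<le> d"
  proof -
    obtain n where n: "(1/2) ^ n < d / 2" using real_arch_pow_inv[of "d/2" "1/2"] d by auto
    have "(1/2 :: real) ^ q (Suc n) \<le> (1/2) ^ n"
      using q_ge[of "Suc n"] by (intro power_decreasing) auto
    with n have "(1/2) ^ q (Suc n) \<le> d / 2" by linarith
    then show ?thesis by (intro exI[of _ n]) (simp add: field_simps)
  qed
  then obtain n where n: "2 / 2 ^ q (Suc n) \<le> d" "\<And>m. m < n \<Longrightarrow> \<not> 2 / 2 ^ q (Suc m) \<le> d"
    unfolding exists_least_iff[where P = "\<lambda>n. 2 / 2 ^ q (Suc n) \<le> d"] by blast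
  have expand: "height n * d / 2 \<le> stair y - stair x"
    using stair_expand[of x n y] assms n by (simp add: d_def)
  have up: "d < 2 / 2 ^ q n"
  proof (cases n)
    case 0
    show ?thesis
    proof (rule ccontr)
      assume "\<not> d < 2 / 2 ^ q n"
      then have "height n * (2 / 2 ^ q n) \<le> height n * d"
        using height_pos[of n] by (intro mult_left_mono) auto
      then have "2 * scale n \<le> height n * d" by (simp add: scale_def mult.commute)
      then have "scale n \<le> stair y - stair x" using expand by linarith
      then show False using assms 0 by simp
    qed
  next
    case (Suc m)
    then show ?thesis using n(2)[of m] by simp
  qed
  define s where "s = height n * d / 2"
  have s: "0 < s" using d height_pos[of n] by (simp add: s_def)
  have "height n * d \<le> height n * (2 / 2 ^ q n)"
    using up height_pos[of n] by (intro mult_left_mono) auto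
  then have "s \<le> (1/2) ^ q n"
    using scale_le[of n] scale_pos[of n] by (simp add: s_def scale_def)
  then have "2 ^ n * phi s \<le> \<Phi> s" using s by (intro \<Phi>)
  also have "\<dots> \<le> \<Phi> (stair y - stair x)"
    using mono s expand by (intro strict_mono_on_leD[OF mono]) (auto simp: s_def)
  finally show ?thesis
    using phi_stair_scale[of d n] d up by (simp add: s_def d_def algebra_simps)
qed

end

section \<open>A Cantor set in the plane\<close>

context staircase
begin

definition unit_square :: "complex set" where
  "unit_square = {z. 0 \<le> Re z \<and> Re z < 1 \<and> 0 \<le> Im z \<and> Im z < 1}"

definition plane_stair :: "complex \<Rightarrow> complex" where
  "plane_stair z = Complex (stair (Re z)) (stair (Im z))"

definition cantor :: "complex set" where
  "cantor = closure (plane_stair ` unit_square)"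

text \<open>The lower left corners of the squares of generation \<open>n\<close>.\<close>

definition nodes :: "nat \<Rightarrow> complex set" where
  "nodes n = (\<lambda>(i, j). plane_stair (Complex (real i / 2 ^ q n) (real j / 2 ^ q n))) `
     ({..<2 ^ q n} \<times> {..<2 ^ q n})"

lemma finite_nodes: "finite (nodes n)"
  by (simp add: nodes_def)

lemma card_nodes: "card (nodes n) \<le> 4 ^ q n"
proof -
  have "card (nodes n) \<le> card ({..<2 ^ q n :: nat} \<times> {..<2 ^ q n :: nat})"
    unfolding nodes_def by (rule card_image_le) simp
  also have "\<dots> = 2 ^ q n * 2 ^ q n" by (simp add: card_cartesian_product)
  also have "\<dots> = 4 ^ q n" by (simp only: power_mult_distrib[symmetric]) simp
  finally show ?thesis .
qed

lemma nodes_subset_cantor: "nodes n \<subseteq> cantor"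
proof -
  have "nodes n \<subseteq> plane_stair ` unit_square"
    unfolding nodes_def unit_square_def
    by (auto intro!: imageI simp: of_nat_less_numeral_power_cancel_iff)
  then show ?thesis unfolding cantor_def using closure_subset by blast
qed

lemma stair_near_grid:
  assumes "0 \<le> x" "x < 1"
  obtains i :: nat where "i < 2 ^ q n" "\<bar>stair x - stair (real i / 2 ^ q n)\<bar> \<le> 2 * scale n"
proof -
  define i where "i = nat \<lfloor>2 ^ q n * x\<rfloor>"
  have i: "real i = \<lfloor>2 ^ q n * x\<rfloor>" using assms by (simp add: i_def)
  have fl: "real i \<le> 2 ^ q n * x" "2 ^ q n * x < real i + 1" unfolding i by linarith+
  then have lo: "real i / 2 ^ q n \<le> x" "x < (real i + 1) / 2 ^ q n"
    by (simp_all add: pos_divide_le_eq pos_less_divide_eq mult.commute)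
  have "2 ^ q n * x < 2 ^ q n * 1" using assms by (intro mult_strict_left_mono) auto
  then have "real i < 2 ^ q n" using fl(1) by linarith
  then have "i < 2 ^ q n" by (simp add: of_nat_less_numeral_power_cancel_iff)
  moreover have "\<bar>stair x - stair (real i / 2 ^ q n)\<bar> \<le> 2 * scale n"
    using stair_step[OF lo] stair_mono[of "real i / 2 ^ q n" x] lo by auto
  ultimately show ?thesis using that by blast
qed

lemma cantor_covered: "cantor \<subseteq> (\<Union>g\<in>nodes n. cball g (4 * scale n))"
  unfolding cantor_def
proof (rule closure_minimal)
  show "closed (\<Union>g\<in>nodes n. cball g (4 * scale n))"
    using finite_nodes by (intro closed_UN) auto
  show "plane_stair ` unit_square \<subseteq> (\<Union>g\<in>nodes n. cball g (4 * scale n))"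
  proof safe
    fix z assume "z \<in> unit_square"
    then have z: "0 \<le> Re z" "Re z < 1" "0 \<le> Im z" "Im z < 1" by (auto simp: unit_square_def)
    obtain i where i: "i < 2 ^ q n" "\<bar>stair (Re z) - stair (real i / 2 ^ q n)\<bar> \<le> 2 * scale n"
      using stair_near_grid z(1,2) .
    obtain j where j: "j < 2 ^ q n" "\<bar>stair (Im z) - stair (real j / 2 ^ q n)\<bar> \<le> 2 * scale n"
      using stair_near_grid z(3,4) .
    define g where "g = plane_stair (Complex (real i / 2 ^ q n) (real j / 2 ^ q n))"
    have "g \<in> nodes n" using i j by (auto simp: nodes_def g_def)
    moreover have "cmod (plane_stair z - g) \<le> \<bar>Re (plane_stair z - g)\<bar> + \<bar>Im (plane_stair z - g)\<bar>"
      by (rule cmod_le)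
    then have "cmod (plane_stair z - g) \<le> 4 * scale n"
      using i j by (simp add: g_def plane_stair_def)
    then have "plane_stair z \<in> cball g (4 * scale n)" by (simp add: dist_norm norm_minus_commute)
    ultimately show "plane_stair z \<in> (\<Union>g\<in>nodes n. cball g (4 * scale n))" by blast
  qed
qed

lemma compact_cantor: "compact cantor"
proof -
  have "bounded (\<Union>g\<in>nodes 0. cball g (4 * scale 0))"
    using finite_nodes by (intro bounded_UN) (auto simp del: mem_cball)
  then have "bounded cantor" using cantor_covered by (rule bounded_subset)
  then show ?thesis by (simp add: cantor_def compact_eq_bounded_closed)
qed

text \<open>The mass distribution principle without a measure on the Cantor set: a covering of the set is
  pulled back along \<^const>\<open>plane_stair\<close> to a covering of the unit square. A set of diameter \<open>d\<close>
  pulls back into a disc of area at most a constant times \<open>\<Phi> d\<close>, and these areas must add up to at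
  least that of a disc in the square.\<close>

lemma hausdorff_measure_cantor_pos:
  assumes \<Phi>: "\<And>n s. 0 < s \<Longrightarrow> s \<le> (1/2) ^ q n \<Longrightarrow> 2 ^ n * phi s \<le> \<Phi> s"
    and mono: "strict_mono_on {0..} \<Phi>" and zero: "\<Phi> 0 = 0"
  shows "hausdorff_measure \<Phi> cantor > 0"
proof -
  define \<delta> where "\<delta> = scale 0 / 2"
  have \<delta>: "0 < \<delta>" "\<delta> < scale 0" using scale_pos[of 0] by (auto simp: \<delta>_def)
  have \<Phi>_mono: "\<Phi> s \<le> \<Phi> t" if "0 \<le> s" "s \<le> t" for s t
    using that by (intro strict_mono_on_leD[OF mono]) auto
  have close: "\<bar>y - x\<bar>\<^sup>2 \<le> 12 * \<Phi> d"
    if "0 \<le> x" "0 \<le> y" "\<bar>stair y - stair x\<bar> \<le> d" "d \<le> \<delta>" for x y d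
  proof -
    have "(v - u)\<^sup>2 \<le> 12 * \<Phi> d" if "0 \<le> u" "u < v" "stair v - stair u \<le> d" for u v
    proof -
      have "(v - u)\<^sup>2 \<le> 12 * \<Phi> (stair v - stair u)"
        using \<Phi> mono that \<open>d \<le> \<delta>\<close> \<delta> by (intro square_le_gauge_stair_diff) auto
      also have "\<dots> \<le> 12 * \<Phi> d"
        using that stair_mono[of u v] by (intro mult_left_mono \<Phi>_mono) auto
      finally show ?thesis .
    qed
    note this[of x y] this[of y x]
    moreover have "0 \<le> \<Phi> d" using \<Phi>_mono[of 0 d] zero that by auto
    ultimately show ?thesis using that
      by (cases x y rule: linorder_cases) (auto simp: power2_commute)
  qed
  have box: "\<exists>B. plane_stair -` E \<inter> unit_square \<subseteq> B \<and> B \<in> sets borel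
      \<and> emeasure lborel B \<le> ennreal (24 * pi) * ennreal (\<Phi> (diameter E))"
    if E: "bounded E" "diameter E \<le> \<delta>" for E
  proof (cases "plane_stair -` E \<inter> unit_square = {}")
    case True
    then show ?thesis by (intro exI[of _ "{}"]) auto
  next
    case False
    then obtain z where z: "z \<in> plane_stair -` E" "z \<in> unit_square" by blast
    define r where "r = sqrt (24 * \<Phi> (diameter E))"
    have nonneg: "0 \<le> \<Phi> (diameter E)"
      using \<Phi>_mono[of 0 "diameter E"] zero diameter_ge_0[OF E(1)] by simp
    have "w \<in> cball z r" if w: "w \<in> plane_stair -` E" "w \<in> unit_square" for w
    proof -
      have d: "dist (plane_stair z) (plane_stair w) \<le> diameter E"
        using E z w by (intro diameter_bounded_bound) auto
      have "\<bar>stair (Re z) - stair (Re w)\<bar> \<le> diameter E"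
        using order_trans[OF abs_Re_le_cmod d[unfolded dist_norm]] by (simp add: plane_stair_def)
      then have "\<bar>Re z - Re w\<bar>\<^sup>2 \<le> 12 * \<Phi> (diameter E)"
        using z w E by (intro close) (auto simp: unit_square_def)
      moreover have "\<bar>stair (Im z) - stair (Im w)\<bar> \<le> diameter E"
        using order_trans[OF abs_Im_le_cmod d[unfolded dist_norm]] by (simp add: plane_stair_def)
      then have "\<bar>Im z - Im w\<bar>\<^sup>2 \<le> 12 * \<Phi> (diameter E)"
        using z w E by (intro close) (auto simp: unit_square_def)
      ultimately have "(cmod (z - w))\<^sup>2 \<le> 24 * \<Phi> (diameter E)"
        by (simp add: cmod_power2)
      then show ?thesis unfolding r_def by (simp add: dist_norm real_le_rsqrt)
    qed
    moreover have "emeasure lborel (cball z r) = ennreal (24 * pi) * ennreal (\<Phi> (diameter E))"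
      using nonneg by (simp add: emeasure_cball unit_ball_vol_2 r_def mult_ac flip: ennreal_mult')
    ultimately show ?thesis by (intro exI[of _ "cball z r"]) auto
  qed

  have "ennreal (1 / 384) \<le> hausdorff_content \<Phi> \<delta> cantor"
    unfolding hausdorff_content_def
  proof (rule INF_greatest)
    fix E :: "nat \<Rightarrow> complex set"
    assume "E \<in> {E. cantor \<subseteq> \<Union> (range E) \<and> (\<forall>i. bounded (E i) \<and> diameter (E i) \<le> \<delta>)}"
    then have cover: "cantor \<subseteq> (\<Union>i. E i)"
      and E: "\<And>i. bounded (E i)" "\<And>i. diameter (E i) \<le> \<delta>" by auto
    have "\<forall>i. \<exists>B. plane_stair -` E i \<inter> unit_square \<subseteq> B \<and> B \<in> sets borel
      \<and> emeasure lborel B \<le> ennreal (24 * pi) * ennreal (\<Phi> (diameter (E i)))"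
      using box E by blast
    then obtain B where B: "\<And>i. plane_stair -` E i \<inter> unit_square \<subseteq> B i" "\<And>i. B i \<in> sets borel"
      "\<And>i. emeasure lborel (B i) \<le> ennreal (24 * pi) * ennreal (\<Phi> (diameter (E i)))"
      by metis
    have ball: "cball (Complex (1/2) (1/2)) (1/4) \<subseteq> unit_square"
    proof
      fix w assume "w \<in> cball (Complex (1/2) (1/2)) (1/4)"
      then have w: "cmod (Complex (1/2) (1/2) - w) \<le> 1/4" by (simp add: dist_norm)
      have "\<bar>1/2 - Re w\<bar> \<le> 1/4" "\<bar>1/2 - Im w\<bar> \<le> 1/4"
        using order_trans[OF abs_Re_le_cmod w] order_trans[OF abs_Im_le_cmod w] by simp_all
      then show "w \<in> unit_square" unfolding unit_square_def mem_Collect_eq by linarith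
    qed
    have "unit_square \<subseteq> (\<Union>i. B i)"
    proof
      fix z assume z: "z \<in> unit_square"
      then have "plane_stair z \<in> cantor" unfolding cantor_def by (intro subsetD[OF closure_subset] imageI)
      then obtain i where "plane_stair z \<in> E i" using cover by auto
      then have "z \<in> B i" using z by (intro subsetD[OF B(1)]) simp
      then show "z \<in> (\<Union>i. B i)" by blast
    qed
    with ball have "emeasure lborel (cball (Complex (1/2) (1/2)) (1/4)) \<le> emeasure lborel (\<Union>i. B i)"
      using B by (intro emeasure_mono) auto
    also have "\<dots> \<le> (\<Sum>i. emeasure lborel (B i))"
      using B by (intro emeasure_subadditive_countably) auto
    also have "\<dots> \<le> (\<Sum>i. ennreal (24 * pi) * ennreal (\<Phi> (diameter (E i))))"
      using B by (intro suminf_le) auto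
    also have "\<dots> = ennreal (24 * pi) * (\<Sum>i. ennreal (\<Phi> (diameter (E i))))"
      by (rule ennreal_suminf_cmult)
    finally have "ennreal (pi / 16) \<le> ennreal (24 * pi) * (\<Sum>i. ennreal (\<Phi> (diameter (E i))))"
      by (simp add: emeasure_cball unit_ball_vol_2 power2_eq_square)
    then have "ennreal (1 / (24 * pi)) * ennreal (pi / 16)
        \<le> ennreal (1 / (24 * pi)) * (ennreal (24 * pi) * (\<Sum>i. ennreal (\<Phi> (diameter (E i)))))"
      by (rule mult_left_mono) simp
    then show "ennreal (1 / 384) \<le> (\<Sum>i. ennreal (\<Phi> (diameter (E i))))"
      by (simp add: mult.assoc[symmetric] flip: ennreal_mult')
  qed
  also have "\<dots> \<le> hausdorff_measure \<Phi> cantor"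
    unfolding hausdorff_measure_eq_SUP using \<delta> by (intro SUP_upper) auto
  finally show ?thesis by (rule less_le_trans[rotated]) simp
qed

text \<open>The squares of generation \<open>n\<close> have total area about \<open>(height n)\<^sup>2\<close>, which tends to \<open>0\<close>. This
  gives room for atoms outside the Cantor set arbitrarily close to each of its points.\<close>

lemma interior_cantor: "interior cantor = {}"
proof (rule equals0I)
  fix z assume "z \<in> interior cantor"
  then obtain e where e: "0 < e" "cball z e \<subseteq> cantor" by (auto simp: mem_interior_cball)
  have "pi * e\<^sup>2 \<le> 16 * pi * (height n)\<^sup>2" for n
  proof -
    have four: "(4::real) ^ q n = (2 ^ q n)\<^sup>2" by (simp add: power2_eq_square flip: power_mult_distrib)
    have "ennreal (pi * e\<^sup>2) = emeasure lborel (cball z e)"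
      using e by (simp add: emeasure_cball unit_ball_vol_2)
    also have "\<dots> \<le> emeasure lborel (\<Union>g\<in>nodes n. cball g (4 * scale n))"
      using e cantor_covered[of n] finite_nodes by (intro emeasure_mono sets.finite_UN) auto
    also have "\<dots> \<le> (\<Sum>g\<in>nodes n. emeasure lborel (cball g (4 * scale n)))"
      using finite_nodes by (intro emeasure_subadditive_finite) auto
    also have "\<dots> = (\<Sum>g\<in>nodes n. ennreal (pi * (4 * scale n)\<^sup>2))"
      using scale_pos[of n] by (intro sum.cong refl) (simp add: emeasure_cball unit_ball_vol_2)
    also have "\<dots> = ennreal (real (card (nodes n)) * (pi * (4 * scale n)\<^sup>2))"
      by (simp add: ennreal_mult ennreal_of_nat_eq_real_of_nat)
    also have "\<dots> \<le> ennreal (4 ^ q n * (pi * (4 * scale n)\<^sup>2))"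
      using of_nat_mono[OF card_nodes[of n], where 'a = real]
      by (intro ennreal_leI mult_right_mono) auto
    also have "4 ^ q n * (pi * (4 * scale n)\<^sup>2) = 16 * pi * (height n)\<^sup>2"
      unfolding four by (simp add: scale_def power_mult_distrib power_divide)
    finally show ?thesis by (subst (asm) ennreal_le_iff) auto
  qed
  moreover have lim: "(\<lambda>n. 16 * pi * (height n)\<^sup>2) \<longlonglongrightarrow> 16 * pi * 0\<^sup>2"
    by (intro tendsto_intros summable_LIMSEQ_zero summable_height)
  ultimately have "pi * e\<^sup>2 \<le> 16 * pi * 0\<^sup>2"
    by (intro tendsto_lowerbound[OF lim]) auto
  moreover have "0 < pi * e\<^sup>2" using e by simp
  ultimately show False by simp
qed

lemma exists_measure_nondifferentiable_on_cantor:
  obtains \<nu> where "signed_borel_measure \<nu>"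
    "integrable (total_variation \<nu>) (\<lambda>w. ln (1 + cmod w))"
    "\<And>a. a \<in> cantor \<Longrightarrow> \<not> weak_capacity_differentiable (potential_domain \<nu>) (log_potential \<nu>) a"
proof -
  have "\<exists>p. dist g p < 4 * scale n \<and> p \<notin> cantor" for n g
  proof (rule ccontr)
    assume "\<not> ?thesis"
    then have "ball g (4 * scale n) \<subseteq> cantor" by auto
    then have "g \<in> interior cantor" 
      using scale_pos[of n] by (auto simp: mem_interior intro!: exI[of _ "4 * scale n"])
    then show False by (simp add: interior_cantor)
  qed
  then have "\<forall>n g. \<exists>p. dist g p < 4 * scale n \<and> p \<notin> cantor" by blast
  then obtain p where p: "\<And>n g. dist g (p n g) < 4 * scale n" "\<And>n g. p n g \<notin> cantor"
    by metis
  \<comment> \<open>each node is moved off the Cantor set by less than \<open>4 * scale n\<close>\<close>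
  define G where "G n = p n ` nodes n" for n
  show ?thesis
  proof (rule exists_nowhere_differentiable_potential[of cantor G "\<lambda>n. 12 * scale n"])
    show "\<exists>a\<in>cantor. dist a g < 12 * scale n" if g: "g \<in> G n" for n g
    proof -
      obtain g' where g': "g' \<in> nodes n" "g = p n g'" using g by (auto simp: G_def)
      have "dist g' g < 12 * scale n" using p(1)[of g' n] scale_pos[of n] g'(2) by simp
      then show ?thesis using g' nodes_subset_cantor by blast
    qed
    show "\<exists>g\<in>G n. dist a g < 12 * scale n" if a: "a \<in> cantor" for n a
    proof -
      obtain g where g: "g \<in> nodes n" "dist g a \<le> 4 * scale n" using a cantor_covered[of n] by auto
      then have "dist a (p n g) < 12 * scale n"
        using p(1)[of g n] scale_pos[of n] dist_triangle[of a "p n g" g] by (simp add: dist_commute)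
      then show ?thesis using g by (auto simp: G_def)
    qed
    show "12 * scale n \<le> exp (-1)" for n
      using scale_le[of n] half_power_q_le[of n] by linarith
    show "(\<lambda>n. 12 * scale n) \<longlonglongrightarrow> 0"
    proof (rule tendsto_sandwich)
      show "\<forall>\<^sub>F n in sequentially. 12 * scale n \<le> (1/2) ^ n"
      proof (intro always_eventually allI)
        fix n
        have "(1/2 :: real) ^ q n \<le> (1/2) ^ n" using q_ge[of n] by (intro power_decreasing) auto
        then show "12 * scale n \<le> (1/2) ^ n" using scale_le[of n] by linarith
      qed
      show "\<forall>\<^sub>F n in sequentially. 0 \<le> 12 * scale n"
        using scale_pos by (simp add: less_imp_le)
      show "(\<lambda>n. (1/2 :: real) ^ n) \<longlonglongrightarrow> 0" by (rule LIMSEQ_realpow_zero) auto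
    qed simp
    have phi_nonneg: "0 \<le> phi (12 * scale n)" for n
    proof -
      have "12 * scale n \<le> exp (-1)" using scale_le[of n] half_power_q_le[of n] by linarith
      moreover have "12 * scale n < 1" by (rule le_less_trans[OF calculation]) simp
      ultimately show ?thesis using scale_pos[of n] by (simp add: phi_def)
    qed
    show "summable (\<lambda>n. real (card (G n)) * phi (12 * scale n))"
    proof (rule summable_comparison_test')
      show "summable (\<lambda>n. 24 * (1/2 :: real) ^ n)" by (intro summable_mult summable_geometric) auto
      fix n
      have "card (G n) \<le> 4 ^ q n"
        unfolding G_def using card_image_le[OF finite_nodes] card_nodes by (rule order_trans)
      then have "real (card (G n)) \<le> 4 ^ q n"
        by (metis of_nat_mono of_nat_numeral of_nat_power)
      then have "real (card (G n)) * phi (12 * scale n) \<le> 4 ^ q n * phi (12 * scale n)"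
        using phi_nonneg by (intro mult_right_mono) auto
      also have "\<dots> \<le> 24 * (1/2) ^ n" by (rule phi_scale_le)
      finally show "norm (real (card (G n)) * phi (12 * scale n)) \<le> 24 * (1/2) ^ n"
        using phi_nonneg by simp
    qed
  qed (use compact_cantor finite_nodes p scale_pos that in \<open>auto simp: G_def\<close>)
qed

end

section \<open>Choice of the scales\<close>

lemma hausdorff_measure_empty:
  assumes "\<Phi> 0 = 0"
  shows "hausdorff_measure \<Phi> ({} :: 'a::metric_space set) = 0"
proof -
  have "hausdorff_content \<Phi> \<delta> ({} :: 'a set) \<le> 0" if "0 < \<delta>" for \<delta>
    unfolding hausdorff_content_def
    by (rule INF_lower2[of "\<lambda>_. {}"]) (use assms that in auto)
  then show ?thesis unfolding hausdorff_measure_eq_SUP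
    by (intro antisym SUP_least) auto
qed

text \<open>Divergence of \<open>\<Phi> / phi\<close> gives a threshold for each bound \<open>\<Phi> \<ge> 2 ^ n * phi\<close>; taking
  partial sums makes the exponents increase.\<close>

lemma exists_scale_exponents:
  assumes "filterlim (\<lambda>r. \<Phi> r / phi r) at_top (at_right 0)"
  obtains q :: "nat \<Rightarrow> nat" where "staircase q"
    "\<And>n s. 0 < s \<Longrightarrow> s \<le> (1/2) ^ q n \<Longrightarrow> 2 ^ n * phi s \<le> \<Phi> s"
proof -
  have "\<exists>Q. \<forall>s. 0 < s \<longrightarrow> s \<le> (1/2) ^ Q \<longrightarrow> 2 ^ n * phi s \<le> \<Phi> s" for n :: nat
  proof -
    have "\<forall>\<^sub>F r in at_right 0. 2 ^ n \<le> \<Phi> r / phi r"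
      using assms by (auto simp: filterlim_at_top)
    then obtain b where b: "0 < b" "\<And>r. 0 < r \<Longrightarrow> r < b \<Longrightarrow> 2 ^ n \<le> \<Phi> r / phi r"
      by (auto simp: eventually_at_right_field)
    obtain Q where Q: "(1/2 :: real) ^ Q < min b (exp (-1))"
      using real_arch_pow_inv[of "min b (exp (-1))" "1/2"] b by auto
    have "2 ^ n * phi s \<le> \<Phi> s" if s: "0 < s" "s \<le> (1/2) ^ Q" for s
    proof -
      have "s < b" "s \<le> exp (-1)" using s Q by auto
      moreover have "s < 1" using \<open>s \<le> exp (-1)\<close> by (rule le_less_trans) simp
      ultimately have "0 < phi s" using s by (simp add: phi_def)
      then show ?thesis using b(2)[of s] s \<open>s < b\<close> by (simp add: pos_le_divide_eq)
    qed
    then show ?thesis by blast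
  qed
  then obtain Q where Q: "\<And>n s. 0 < s \<Longrightarrow> s \<le> (1/2) ^ Q n \<Longrightarrow> 2 ^ n * phi s \<le> \<Phi> s"
    by metis
  define q where "q n = n + 10 + (\<Sum>k\<le>n. Q k)" for n
  have "staircase q"
    by unfold_locales (auto simp: q_def strict_mono_Suc_iff)
  moreover have "2 ^ n * phi s \<le> \<Phi> s" if "0 < s" "s \<le> (1/2) ^ q n" for n s
  proof -
    have "Q n \<le> (\<Sum>k\<le>n. Q k)" by (rule member_le_sum) auto
    then have "(1/2 :: real) ^ q n \<le> (1/2) ^ Q n" by (intro power_decreasing) (auto simp: q_def)
    then show ?thesis using that by (intro Q order_trans[OF that(2)])
  qed
  ultimately show ?thesis using that by blast
qed

theorem theorem6:
  fixes \<Phi> :: "real \<Rightarrow> real"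
  assumes "\<And>t. t \<ge> 0 \<Longrightarrow> \<Phi> t \<ge> 0"
    and "\<Phi> 0 = 0"
    and "continuous_on {0..} \<Phi>"
    and "strict_mono_on {0..} \<Phi>"
    and "Limsup (at_right 0) (\<lambda>r. ereal (\<Phi> (2 * r) / \<Phi> r)) < 4"
    and "filterlim (\<lambda>r. \<Phi> r / phi r) at_top (at_right 0)"
  shows "\<exists>(K :: complex set) (\<nu> :: complex set \<Rightarrow> real).
           compact K \<and> hausdorff_measure \<Phi> K > 0 \<and>
           signed_borel_measure \<nu> \<and>
           integrable (total_variation \<nu>) (\<lambda>w. ln (1 + cmod w)) \<and>
           hausdorff_measure \<Phi>
             {a \<in> K. weak_capacity_differentiable (potential_domain \<nu>) (log_potential \<nu>) a} = 0"
proof -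
  obtain q where "staircase q"
    and \<Phi>: "\<And>n s. 0 < s \<Longrightarrow> s \<le> (1/2) ^ q n \<Longrightarrow> 2 ^ n * phi s \<le> \<Phi> s"
    using exists_scale_exponents[OF assms(6)] by blast
  interpret staircase q by fact
  obtain \<nu> where \<nu>: "signed_borel_measure \<nu>"
    "integrable (total_variation \<nu>) (\<lambda>w. ln (1 + cmod w))"
    and nondiff: "\<And>a. a \<in> cantor \<Longrightarrow>
      \<not> weak_capacity_differentiable (potential_domain \<nu>) (log_potential \<nu>) a"
    using exists_measure_nondifferentiable_on_cantor by blast
  have empty: "{a \<in> cantor. weak_capacity_differentiable (potential_domain \<nu>) (log_potential \<nu>) a} = {}"
    using nondiff by blast
  then show ?thesis
    using compact_cantor hausdorff_measure_cantor_pos[OF \<Phi> assms(4,2)] \<nu>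
      hausdorff_measure_empty[of \<Phi>, OF assms(2)]
    by (intro exI[of _ cantor] exI[of _ \<nu>]) (simp only: empty simp_thms)
qed

end
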